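(* Let $A\in\mathbb{R}\setminus\{0\}$ and $B,a_0,b_0\in\mathbb{R}$ with $a_0+b_0=B$, and put $a(\epsilon)=a_0+\frac{A}{\epsilon}$, $b(\epsilon)=b_0-\frac{A}{\epsilon}$ for $\epsilon\in(0,1]$; assume $b(\epsilon)\ne0$ for all $\epsilon\in(0,1]$. Let $L>0$, let $0\neq\psi\in L^2(\mathbb{R},dx)$ have support contained in $[-L,L]$, let $p_0=\frac{\pi}{AL}$ and let $q_0\in\mathbb{R}$ satisfy $|q_0p_0|<2\pi$. Suppose there is a constant $\chi>0$ with $\sum_{n\in\mathbb{Z}}|\psi(x+nq_0)|^2=\chi$ for all $x\in\mathbb{R}$. For $\epsilon\in(0,1]$ and $m,n\in\mathbb{Z}$ let $$\alpha_n(\epsilon)=e^{-\epsilon nq_0},\qquad \beta_{mn}(\epsilon)=-\frac{2\pi m\,e^{-\epsilon nq_0}}{b(\epsilon)(e^{\epsilon L}-e^{-\epsilon L})},\qquad \gamma_{mn}(\epsilon)=\beta_{mn}(\epsilon)\frac{\ln\alpha_n(\epsilon)}{\alpha_n(\epsilon)-1},$$ and let $\psi_\epsilon=I(Q_\epsilon\psi)$ with $Q_\epsilon(x)=e^{-\frac12\epsilon x}$. Then for every $\epsilon\in(0,1]$ the sequence $\{|\widehat\psi^{\epsilon,a(\epsilon),b(\epsilon)}_{(n,m)}\rangle\}_{m,n\in\mathbb{Z}}$, where $$|\widehat\psi^{\epsilon,a(\epsilon),b(\epsilon)}_{(n,m)}\rangle=\pi_\epsilon^{a(\epsilon),b(\epsilon)}\big(\alpha_n(\epsilon),\beta_{mn}(\epsilon),\gamma_{mn}(\epsilon)\big)(\psi_\epsilon),$$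 is a tight frame in $\mathcal{H}$ with frame constant $2\frac{\sinh(\epsilon L)}{\epsilon}\chi$.
   Context: $\mathcal{H}=\{f\in L^2(\mathbb{R},dx):\mathcal{F}(f)(w)=0\text{ for } w<0\}$, where $\mathcal{F}(f)(w)=\frac{1}{\sqrt{2\pi}}\int_{\mathbb{R}}f(x)e^{-iwx}dx$. $I:L^2(\mathbb{R},dx)\to\mathcal{H}$ is the unitary operator that is the inverse of $T_1=S_3\circ S_2\circ S_1$, where $S_1:\mathcal{H}\to L^2(\mathbb{R}^+,dx)$, $S_1f=\mathcal{F}(f)|_{\mathbb{R}^+}$; $S_2:L^2(\mathbb{R}^+,dx)\to L^2(\mathbb{R}^+,\frac{dx}{x})$, $(S_2f)(x)=\sqrt{x}f(x)$; $S_3:L^2(\mathbb{R}^+,\frac{dx}{x})\to L^2(\mathbb{R},dx)$, $(S_3f)(x)=f(e^{-x})$. For $\epsilon\in(0,1]$, $a\in\mathbb{R}$, $b\ne0$, $\rho_\epsilon^{a,b}$ is the unitary representation on $L^2(\mathbb{R})$ of the extended affine group $EA=\mathbb{R}^+\times\mathbb{R}\times\mathbb{R}$ (product $(\alpha,\beta,\gamma)(x,y,z)=(\alpha x,\alpha y+\beta,\gamma+z)$) given by $(\rho_\epsilon^{a,b}(\alpha,\beta,\gamma)f)(x)=e^{ia\gamma}e^{ib\beta e^{-\epsilon x}}f\big(x-\tfrac{\log\alpha}{\epsilon}\big)$, and $\pi_\epsilon^{a,b}=I\circ\rho_\epsilon^{a,b}\circ I^{-1}$, acting on $\mathcal{H}$.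 The quotient $\frac{\ln\alpha}{\alpha-1}$ is read as $1$ at $\alpha=1$. A countable family $\{\phi_k\}$ in a Hilbert space is a tight frame with frame constant $K>0$ if $\sum_k|\phi_k\rangle\langle\phi_k|=K\,\mathbb{I}$, equivalently $\sum_k|\langle f|\phi_k\rangle|^2=K\|f\|^2$ for all $f$ in the space. *)

theory Defs
  imports "HOL-Analysis.Analysis"
begin

text \<open>
  Elements of an \<open>L\<^sup>2\<close> space are represented by square-integrable functions, and equality of
  elements is equality almost everywhere. Operators are functions on representatives. An operator
  whose value is determined only up to a null set picks one representative with \<open>SOME\<close>; inner
  products, norms and almost-everywhere statements do not depend on the choice.
\<close>

definition L2 :: "'a measure \<Rightarrow> ('a \<Rightarrow> complex) set" where
  "L2 M = {f \<in> borel_measurable M. integrable M (\<lambda>x. (cmod (f x))\<^sup>2)}"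

definition L2_inner :: "'a measure \<Rightarrow> ('a \<Rightarrow> complex) \<Rightarrow> ('a \<Rightarrow> complex) \<Rightarrow> complex" where
  "L2_inner M f g = (LINT x|M. cnj (f x) * g x)"

definition L2_norm :: "'a measure \<Rightarrow> ('a \<Rightarrow> complex) \<Rightarrow> real" where
  "L2_norm M f = sqrt (LINT x|M. (cmod (f x))\<^sup>2)"

text \<open>A family in the Hilbert space \<open>X\<close>, a closed subspace of \<open>L\<^sup>2(M)\<close>.\<close>

definition tight_frame ::
    "'a measure \<Rightarrow> ('a \<Rightarrow> complex) set \<Rightarrow> ('k::countable \<Rightarrow> 'a \<Rightarrow> complex) \<Rightarrow> real \<Rightarrow> bool" where
  "tight_frame M X \<phi> K \<longleftrightarrow> K > 0 \<and> (\<forall>k. \<phi> k \<in> X) \<and>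
     (\<forall>f\<in>X. ((\<lambda>k. (cmod (L2_inner M f (\<phi> k)))\<^sup>2) has_sum K * (L2_norm M f)\<^sup>2) UNIV)"

definition fourier_integral :: "(real \<Rightarrow> complex) \<Rightarrow> real \<Rightarrow> complex" where
  "fourier_integral f w =
     complex_of_real (1 / sqrt (2 * pi)) * (LINT x|lborel. f x * cis (- (w * x)))"

text \<open>
  For \<open>f\<close> in \<open>L\<^sup>2\<close> but not in \<open>L\<^sup>1\<close> the integral above need not exist. The Fourier transform on
  \<open>L\<^sup>2(\<real>)\<close> is the \<open>L\<^sup>2\<close> limit of the transforms of the truncations of \<open>f\<close> to \<open>[-N, N]\<close>. The
  distance is a nonnegative integral, because the Bochner integral is 0 for functions that are not
  integrable.
\<close>

definition fourier :: "(real \<Rightarrow> complex) \<Rightarrow> real \<Rightarrow> complex" where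
  "fourier f = (SOME g. g \<in> L2 lborel \<and>
     (\<lambda>N::nat. \<integral>\<^sup>+ w. ennreal ((cmod (g w -
         fourier_integral (\<lambda>x. indicator {- real N..real N} x * f x) w))\<^sup>2) \<partial>lborel)
       \<longlonglongrightarrow> 0)"

definition H_space :: "(real \<Rightarrow> complex) set" where
  "H_space = {f \<in> L2 lborel. AE w in lborel. w < 0 \<longrightarrow> fourier f w = 0}"

definition S1 :: "(real \<Rightarrow> complex) \<Rightarrow> real \<Rightarrow> complex" where
  "S1 f = restrict (fourier f) {0<..}"

definition S2 :: "(real \<Rightarrow> complex) \<Rightarrow> real \<Rightarrow> complex" where
  "S2 f = (\<lambda>x\<in>{0<..}. complex_of_real (sqrt x) * f x)"

definition S3 :: "(real \<Rightarrow> complex) \<Rightarrow> real \<Rightarrow> complex" where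
  "S3 f = (\<lambda>x. f (exp (- x)))"

definition T1 :: "(real \<Rightarrow> complex) \<Rightarrow> real \<Rightarrow> complex" where
  "T1 = S3 \<circ> S2 \<circ> S1"

text \<open>The inverse of \<open>T1\<close>, regarded as a map from \<open>H_space\<close> onto \<open>L\<^sup>2(\<real>)\<close>.\<close>

definition I_op :: "(real \<Rightarrow> complex) \<Rightarrow> real \<Rightarrow> complex" where
  "I_op g = (SOME f. f \<in> H_space \<and> (AE x in lborel. T1 f x = g x))"

text \<open>
  A triple \<open>(\<alpha>, \<beta>, \<gamma>)\<close> is an element of the extended affine group when \<open>\<alpha> > 0\<close>.
\<close>

definition rho ::
    "real \<Rightarrow> real \<Rightarrow> real \<Rightarrow> real \<times> real \<times> real \<Rightarrow> (real \<Rightarrow> complex) \<Rightarrow> real \<Rightarrow> complex" where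
  "rho \<epsilon> a b = (\<lambda>(\<alpha>, \<beta>, \<gamma>) f x.
     cis (a * \<gamma>) * cis (b * \<beta> * exp (- \<epsilon> * x)) * f (x - ln \<alpha> / \<epsilon>))"

text \<open>Conjugation of \<open>rho\<close> by \<open>I_op\<close>, whose inverse is \<open>T1\<close>.\<close>

definition pi_rep ::
    "real \<Rightarrow> real \<Rightarrow> real \<Rightarrow> real \<times> real \<times> real \<Rightarrow> (real \<Rightarrow> complex) \<Rightarrow> real \<Rightarrow> complex" where
  "pi_rep \<epsilon> a b g = I_op \<circ> rho \<epsilon> a b g \<circ> T1"

definition ln_quotient :: "real \<Rightarrow> real" where
  "ln_quotient \<alpha> = (if \<alpha> = 1 then 1 else ln \<alpha> / (\<alpha> - 1))"

end

theory Submission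
  imports Defs
begin

text \<open>
  Write \<open>h = T1 f\<close>. As \<open>T1\<close> is unitary, the coefficient of \<open>f\<close> at \<open>(n, m)\<close> is, up to a phase, the
  integral of \<open>cnj (h (y - n q\<^sub>0)) exp (- \<epsilon> y / 2) \<psi> y\<close> against the chirp
  \<open>cis (- 2 \<pi> m exp (- \<epsilon> y) / D)\<close> with \<open>D = 2 sinh (\<epsilon> L)\<close>. The substitution \<open>u = exp (- \<epsilon> y)\<close> turns it
  into a Fourier coefficient of a function supported on an interval of length \<open>D\<close>, so Parseval
  sums over \<open>m\<close> to \<open>D / \<epsilon>\<close> times the integral of \<open>\<bar>h (y - n q\<^sub>0)\<bar>\<^sup>2 \<bar>\<psi> y\<bar>\<^sup>2\<close>, and the sum over \<open>n\<close>
  is resolved by the hypothesis on the translates of \<open>\<psi>\<close>.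

  Unitarity of \<open>T1\<close> needs Plancherel's theorem. For compact support it follows from Parseval:
  apply Parseval to the modulations of \<open>f\<close> by a frequency shift \<open>t\<close> and integrate over \<open>t\<close> in a unit
  interval. Surjectivity of the transform \<open>F\<close> follows from the multiplication formula: \<open>k = F\<^sup>* h\<close>
  satisfies \<open>\<langle>F k, h\<rangle> = \<parallel>k\<parallel>\<^sup>2 = \<parallel>h\<parallel>\<^sup>2\<close>, hence \<open>F k = h\<close>.
\<close>

section \<open>Square-integrable functions\<close>

text \<open>Three choices in the data meet in the substitution. The factor
  \<open>exp (- \<epsilon> * of_int n * q)\<close> in \<open>\<beta>\<close> undoes the dilation of
  the chirp caused by the translation, so one orthogonal system on one interval serves every
  \<open>n\<close>; that interval is the image of \<open>{- L..L}\<close>, whence its length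
  \<open>D\<close>. Absorbing the Jacobian into the function makes its square carry the Jacobian
  twice, once more than the measure uses up; the surplus is
  \<open>exp (\<epsilon> * y) / \<epsilon>\<close>, whose exponential the weight
  \<open>exp (- \<epsilon> * y / 2)\<close> cancels, leaving the \<open>1 / \<epsilon>\<close> of
  the frame constant. Two obstacles shape the rest. \<open>fourier\<close> and \<open>I_op\<close>
  are choices known only up to null sets, so integral formulas are used for truncations and carried
  over by L2 limits; this needs completeness of L2. Sums and integrals are exchanged with values in
  [0, infinity], and only the end returns to \<open>has_sum\<close>. Parseval rests on completeness
  of the exponentials: an integrable function that they annihilate is annihilated, by
  Stone-Weierstrass on the circle, by every continuous function of
  \<open>cis (2 * pi * x / D)\<close>, and then by indicators of closed arcs.\<close>

lemma borel_measurable_cnj [measurable (raw)]: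
  assumes "f \<in> borel_measurable M"
  shows "(\<lambda>x. cnj (f x)) \<in> borel_measurable M"
  by (rule borel_measurable_continuous_on[OF _ assms]) (intro continuous_intros)

text \<open>This form of membership suits limits and substitutions: a bound on a nonnegative
  integral proves it without integrability being known beforehand.\<close>

lemma L2_iff_nn_integral:
  "f \<in> L2 M \<longleftrightarrow> f \<in> borel_measurable M \<and> (\<integral>\<^sup>+x. ennreal ((cmod (f x))\<^sup>2) \<partial>M) < \<infinity>"
  unfolding L2_def by (auto simp: integrable_iff_bounded)

lemma L2_measurable: "f \<in> L2 M \<Longrightarrow> f \<in> borel_measurable M"
  by (simp add: L2_def)

lemma nn_integral_L2:
  assumes "f \<in> L2 M"
  shows "(\<integral>\<^sup>+x. ennreal ((cmod (f x))\<^sup>2) \<partial>M) = ennreal ((L2_norm M f)\<^sup>2)"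
  using assms by (simp add: L2_def L2_norm_def nn_integral_eq_integral)

lemma L2_norm_nonneg [simp]: "0 \<le> L2_norm M f"
  by (simp add: L2_norm_def)

lemma L2_norm_power2: "(L2_norm M f)\<^sup>2 = (LINT x|M. (cmod (f x))\<^sup>2)"
  by (simp add: L2_norm_def)

lemma L2_norm_minus_commute: "L2_norm M (\<lambda>x. f x - g x) = L2_norm M (\<lambda>x. g x - f x)"
  by (simp add: L2_norm_def norm_minus_commute)

lemma L2_norm_cnj [simp]: "L2_norm M (\<lambda>x. cnj (f x)) = L2_norm M f"
  by (simp add: L2_norm_def)

lemma L2_norm_cong_AE:
  assumes "AE x in M. f x = g x" "f \<in> borel_measurable M" "g \<in> borel_measurable M"
  shows "L2_norm M f = L2_norm M g"
proof -
  have "(LINT x|M. (cmod (f x))\<^sup>2) = (LINT x|M. (cmod (g x))\<^sup>2)"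
    using assms(2,3) by (intro integral_cong_AE) (use assms(1) in \<open>auto elim!: eventually_mono\<close>)
  then show ?thesis
    by (simp add: L2_norm_def)
qed

lemma L2_inner_cong_AE:
  assumes "AE x in M. f x = f' x" "AE x in M. g x = g' x"
    and "f \<in> borel_measurable M" "f' \<in> borel_measurable M"
    and "g \<in> borel_measurable M" "g' \<in> borel_measurable M"
  shows "L2_inner M f g = L2_inner M f' g'"
proof -
  note [measurable] = assms(3-6)
  have "AE x in M. cnj (f x) * g x = cnj (f' x) * g' x"
    using assms(1,2) by eventually_elim simp
  then show ?thesis
    unfolding L2_inner_def by (intro integral_cong_AE) auto
qed

lemma L2_cong_AE:
  assumes "AE x in M. f x = g x" "f \<in> L2 M" "g \<in> borel_measurable M"
  shows "g \<in> L2 M"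
proof -
  have "(\<integral>\<^sup>+x. ennreal ((cmod (f x))\<^sup>2) \<partial>M) = (\<integral>\<^sup>+x. ennreal ((cmod (g x))\<^sup>2) \<partial>M)"
    by (rule nn_integral_cong_AE) (use assms(1) in \<open>auto elim!: eventually_mono\<close>)
  then show ?thesis
    using assms by (simp add: L2_iff_nn_integral)
qed

lemma L2_bounded_by:
  assumes "f \<in> L2 M" "g \<in> borel_measurable M" "\<And>x. cmod (g x) \<le> cmod (f x)"
  shows "g \<in> L2 M"
proof -
  have "(\<integral>\<^sup>+x. ennreal ((cmod (g x))\<^sup>2) \<partial>M) \<le> (\<integral>\<^sup>+x. ennreal ((cmod (f x))\<^sup>2) \<partial>M)"
    by (intro nn_integral_mono ennreal_leI power_mono assms) auto
  then show ?thesis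
    using assms by (auto simp: L2_iff_nn_integral)
qed

lemma L2_zero [simp]: "(\<lambda>x. 0) \<in> L2 M"
  by (simp add: L2_def)

lemma L2_cmult:
  assumes "f \<in> L2 M"
  shows "(\<lambda>x. c * f x) \<in> L2 M"
  using assms by (auto simp: L2_def norm_mult power_mult_distrib)

lemma L2_cnj:
  assumes "f \<in> L2 M"
  shows "(\<lambda>x. cnj (f x)) \<in> L2 M"
  using assms by (auto simp: L2_def)

lemma L2_add:
  assumes "f \<in> L2 M" "g \<in> L2 M"
  shows "(\<lambda>x. f x + g x) \<in> L2 M"
proof -
  have [measurable]: "f \<in> borel_measurable M" "g \<in> borel_measurable M"
    using assms by (auto simp: L2_def)
  have le: "(cmod (u + v))\<^sup>2 \<le> 2 * (cmod u)\<^sup>2 + 2 * (cmod v)\<^sup>2" for u v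
  proof -
    have "(cmod (u + v))\<^sup>2 \<le> (cmod u + cmod v)\<^sup>2"
      by (intro power_mono norm_triangle_ineq) auto
    also have "\<dots> \<le> 2 * (cmod u)\<^sup>2 + 2 * (cmod v)\<^sup>2"
      using sum_squares_bound[of "cmod u" "cmod v"] by (simp add: power2_sum)
    finally show ?thesis .
  qed
  have "integrable M (\<lambda>x. 2 * (cmod (f x))\<^sup>2 + 2 * (cmod (g x))\<^sup>2)"
    using assms by (auto simp: L2_def)
  then have "integrable M (\<lambda>x. (cmod (f x + g x))\<^sup>2)"
    by (rule Bochner_Integration.integrable_bound)
      (measurable, intro always_eventually allI, use le in simp)
  then show ?thesis
    by (simp add: L2_def)
qed

lemma L2_diff:
  assumes "f \<in> L2 M" "g \<in> L2 M"
  shows "(\<lambda>x. f x - g x) \<in> L2 M"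
  using L2_add[OF assms(1) L2_cmult[OF assms(2), of "-1"]] by simp

lemma L2_sum:
  assumes "\<And>i. i \<in> I \<Longrightarrow> f i \<in> L2 M"
  shows "(\<lambda>x. \<Sum>i\<in>I. f i x) \<in> L2 M"
  using assms by (induction I rule: infinite_finite_induct) (auto intro: L2_add)

lemma L2_mult_integrable:
  assumes "f \<in> L2 M" "g \<in> L2 M"
  shows "integrable M (\<lambda>x. f x * g x)"
proof -
  have [measurable]: "f \<in> borel_measurable M" "g \<in> borel_measurable M"
    using assms by (auto simp: L2_def)
  have le: "cmod (u * v) \<le> norm ((cmod u)\<^sup>2 + (cmod v)\<^sup>2)" for u v
    using sum_squares_bound[of "cmod u" "cmod v"] mult_nonneg_nonneg[of "cmod u" "cmod v"]
    by (simp add: norm_mult mult.assoc del: mult_nonneg_nonneg zero_le_mult_iff)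
  have "integrable M (\<lambda>x. (cmod (f x))\<^sup>2 + (cmod (g x))\<^sup>2)"
    using assms by (auto simp: L2_def)
  then show ?thesis
    by (rule Bochner_Integration.integrable_bound) (measurable, intro always_eventually allI le)
qed

lemma L2_inner_integrable:
  assumes "f \<in> L2 M" "g \<in> L2 M"
  shows "integrable M (\<lambda>x. cnj (f x) * g x)"
  using L2_mult_integrable[OF L2_cnj[OF assms(1)] assms(2)] .

lemma L2_inner_self: "L2_inner M f f = complex_of_real ((L2_norm M f)\<^sup>2)"
proof -
  have "L2_inner M f f = (LINT x|M. complex_of_real ((cmod (f x))\<^sup>2))"
    unfolding L2_inner_def
    by (rule Bochner_Integration.integral_cong[OF refl]) (metis complex_norm_square mult.commute of_real_power)
  also have "\<dots> = complex_of_real (LINT x|M. (cmod (f x))\<^sup>2)"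
    by (rule integral_complex_of_real)
  finally show ?thesis
    by (simp add: L2_norm_power2)
qed

lemma L2_inner_diff_right:
  assumes "f \<in> L2 M" "g \<in> L2 M" "h \<in> L2 M"
  shows "L2_inner M f (\<lambda>x. g x - h x) = L2_inner M f g - L2_inner M f h"
  using assms by (simp add: L2_inner_def right_diff_distrib L2_inner_integrable)

lemma L2_inner_cmult_right: "L2_inner M f (\<lambda>x. c * g x) = c * L2_inner M f g"
proof -
  have "L2_inner M f (\<lambda>x. c * g x) = (LINT x|M. c * (cnj (f x) * g x))"
    by (simp add: L2_inner_def mult_ac)
  then show ?thesis
    by (simp add: L2_inner_def)
qed

lemma L2_inner_sum_right:
  assumes "f \<in> L2 M" "\<And>i. i \<in> I \<Longrightarrow> g i \<in> L2 M"
  shows "L2_inner M f (\<lambda>x. \<Sum>i\<in>I. g i x) = (\<Sum>i\<in>I. L2_inner M f (g i))"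
  using assms by (simp add: L2_inner_def sum_distrib_left L2_inner_integrable)

lemma L2_inner_commute: "L2_inner M f g = cnj (L2_inner M g f)"
proof -
  have "cnj (L2_inner M g f) = (LINT x|M. cnj (cnj (g x) * f x))"
    unfolding L2_inner_def by (simp only: Bochner_Integration.integral_cnj[symmetric])
  then show ?thesis
    by (simp add: L2_inner_def mult.commute)
qed

lemma L2_inner_diff_left:
  assumes "f \<in> L2 M" "g \<in> L2 M" "h \<in> L2 M"
  shows "L2_inner M (\<lambda>x. g x - h x) f = L2_inner M g f - L2_inner M h f"
  using assms by (simp add: L2_inner_def left_diff_distrib L2_inner_integrable)

text \<open>The free scalar \<open>c\<close> serves polarization: an operator that preserves the
  left side for every \<open>c\<close> preserves the complex inner product. The value
  \<open>c = -1\<close> gives distances.\<close>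

lemma L2_norm_add_power2:
  assumes "f \<in> L2 M" "g \<in> L2 M"
  shows "(L2_norm M (\<lambda>x. f x + c * g x))\<^sup>2 =
    (L2_norm M f)\<^sup>2 + (cmod c)\<^sup>2 * (L2_norm M g)\<^sup>2 + 2 * Re (c * L2_inner M f g)"
proof -
  have i: "integrable M (\<lambda>x. (cmod (f x))\<^sup>2)" "integrable M (\<lambda>x. (cmod (g x))\<^sup>2)"
    using assms by (auto simp: L2_def)
  have "(cmod (u + c * v))\<^sup>2 = (cmod u)\<^sup>2 + (cmod c)\<^sup>2 * (cmod v)\<^sup>2 + 2 * Re (c * (cnj u * v))" for u v
    unfolding cmod_power2 by (simp add: power2_eq_square algebra_simps)
  then have "(L2_norm M (\<lambda>x. f x + c * g x))\<^sup>2 =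
      (LINT x|M. (cmod (f x))\<^sup>2 + (cmod c)\<^sup>2 * (cmod (g x))\<^sup>2 + 2 * Re (c * (cnj (f x) * g x)))"
    by (simp add: L2_norm_power2)
  also have "\<dots> = (L2_norm M f)\<^sup>2 + (cmod c)\<^sup>2 * (L2_norm M g)\<^sup>2
      + 2 * (LINT x|M. Re (c * (cnj (f x) * g x)))"
    using i L2_inner_integrable[OF assms]
    by (simp add: L2_norm_power2 integrable_Re del: complex_cnj_mult times_complex.sel)
  also have "(LINT x|M. Re (c * (cnj (f x) * g x))) = Re (LINT x|M. c * (cnj (f x) * g x))"
    using L2_inner_integrable[OF assms] by (intro integral_Re) auto
  also have "(LINT x|M. c * (cnj (f x) * g x)) = c * L2_inner M f g"
    by (simp add: L2_inner_def)
  finally show ?thesis .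
qed

lemma L2_norm_diff_power2:
  assumes "f \<in> L2 M" "g \<in> L2 M"
  shows "(L2_norm M (\<lambda>x. f x - g x))\<^sup>2 =
    (L2_norm M f)\<^sup>2 + (L2_norm M g)\<^sup>2 - 2 * Re (L2_inner M f g)"
  using L2_norm_add_power2[OF assms, of "-1"] by simp

text \<open>The inequality for nonnegative integrals is applied to the moduli, which avoids any
  division by a norm that may vanish.\<close>

lemma L2_Cauchy_Schwarz:
  assumes "f \<in> L2 M" "g \<in> L2 M"
  shows "cmod (L2_inner M f g) \<le> L2_norm M f * L2_norm M g"
proof -
  have [measurable]: "f \<in> borel_measurable M" "g \<in> borel_measurable M"
    using assms by (auto simp: L2_def)
  let ?I = "LINT x|M. cmod (cnj (f x) * g x)"
  have "ennreal ?I = (\<integral>\<^sup>+x. ennreal (cmod (cnj (f x) * g x)) \<partial>M)"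
    using L2_inner_integrable[OF assms] by (intro nn_integral_eq_integral[symmetric]) auto
  also have "\<dots> = (\<integral>\<^sup>+x. ennreal (cmod (f x)) * ennreal (cmod (g x)) \<partial>M)"
    by (simp add: norm_mult ennreal_mult)
  finally have "(ennreal ?I)\<^sup>2 = (\<integral>\<^sup>+x. ennreal (cmod (f x)) * ennreal (cmod (g x)) \<partial>M)\<^sup>2"
    by simp
  also have "\<dots> \<le> (\<integral>\<^sup>+x. (ennreal (cmod (f x)))\<^sup>2 \<partial>M) * (\<integral>\<^sup>+x. (ennreal (cmod (g x)))\<^sup>2 \<partial>M)"
    by (rule Cauchy_Schwarz_nn_integral) auto
  also have "\<dots> = ennreal ((L2_norm M f)\<^sup>2) * ennreal ((L2_norm M g)\<^sup>2)"
    using nn_integral_L2[OF assms(1)] nn_integral_L2[OF assms(2)] by (simp add: ennreal_power)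
  also have "\<dots> = ennreal ((L2_norm M f * L2_norm M g)\<^sup>2)"
    by (simp add: ennreal_mult power_mult_distrib)
  finally have "ennreal (?I\<^sup>2) \<le> ennreal ((L2_norm M f * L2_norm M g)\<^sup>2)"
    by (subst (asm) ennreal_power) auto
  then have "?I\<^sup>2 \<le> (L2_norm M f * L2_norm M g)\<^sup>2"
    by (subst (asm) ennreal_le_iff) auto
  then have "?I \<le> L2_norm M f * L2_norm M g"
    by (rule power2_le_imp_le) auto
  moreover have "cmod (L2_inner M f g) \<le> ?I"
    unfolding L2_inner_def by (rule integral_norm_bound)
  ultimately show ?thesis
    by linarith
qed

lemma L2_norm_triangle:
  assumes "f \<in> L2 M" "g \<in> L2 M"
  shows "L2_norm M (\<lambda>x. f x + g x) \<le> L2_norm M f + L2_norm M g"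
proof (rule power2_le_imp_le)
  have "Re (L2_inner M f g) \<le> L2_norm M f * L2_norm M g"
    using L2_Cauchy_Schwarz[OF assms] complex_Re_le_cmod order_trans by blast
  then show "(L2_norm M (\<lambda>x. f x + g x))\<^sup>2 \<le> (L2_norm M f + L2_norm M g)\<^sup>2"
    using L2_norm_add_power2[OF assms, of 1] by (simp add: power2_sum)
qed auto

lemma L2_norm_triangle_diff:
  assumes "f \<in> L2 M" "g \<in> L2 M" "h \<in> L2 M"
  shows "L2_norm M (\<lambda>x. f x - h x) \<le> L2_norm M (\<lambda>x. f x - g x) + L2_norm M (\<lambda>x. g x - h x)"
  using L2_norm_triangle[OF L2_diff[OF assms(1,2)] L2_diff[OF assms(2,3)]] by simp

lemma L2_norm_eq_0_AE:
  assumes "f \<in> L2 M" "L2_norm M f = 0"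
  shows "AE x in M. f x = 0"
proof -
  have [measurable]: "f \<in> borel_measurable M"
    using assms by (simp add: L2_def)
  have "(\<integral>\<^sup>+x. ennreal ((cmod (f x))\<^sup>2) \<partial>M) = 0"
    using nn_integral_L2[OF assms(1)] assms(2) by simp
  then show ?thesis
    by (subst (asm) nn_integral_0_iff_AE) (auto elim!: eventually_mono)
qed

section \<open>Limits, completeness and orthonormal expansions in L2\<close>

lemma L2_inner_tendsto:
  assumes "\<And>n. f n \<in> L2 M" "\<And>n. g n \<in> L2 M" "f' \<in> L2 M" "g' \<in> L2 M"
    and "(\<lambda>n. L2_norm M (\<lambda>x. f n x - f' x)) \<longlonglongrightarrow> 0"
    and "(\<lambda>n. L2_norm M (\<lambda>x. g n x - g' x)) \<longlonglongrightarrow> 0"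
  shows "(\<lambda>n. L2_inner M (f n) (g n)) \<longlonglongrightarrow> L2_inner M f' g'"
proof -
  let ?d = "\<lambda>n. L2_norm M (\<lambda>x. f n x - f' x)" and ?e = "\<lambda>n. L2_norm M (\<lambda>x. g n x - g' x)"
  have "cmod (L2_inner M (f n) (g n) - L2_inner M f' g') \<le>
      ?d n * ?e n + ?d n * L2_norm M g' + L2_norm M f' * ?e n" for n
  proof -
    note d = L2_diff[OF assms(1)[of n] assms(3)] and e = L2_diff[OF assms(2)[of n] assms(4)]
    note cs = L2_Cauchy_Schwarz[OF d e] L2_Cauchy_Schwarz[OF d assms(4)] L2_Cauchy_Schwarz[OF assms(3) e]
    \<comment> \<open>Expansion around the limits: a product of both errors and two terms with a
      single error, each bounded by Cauchy-Schwarz.\<close>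
    have eq: "L2_inner M (f n) (g n) - L2_inner M f' g' =
       L2_inner M (\<lambda>x. f n x - f' x) (\<lambda>x. g n x - g' x) + L2_inner M (\<lambda>x. f n x - f' x) g'
        + L2_inner M f' (\<lambda>x. g n x - g' x)"
      using assms(1-4) by (simp add: L2_inner_diff_left L2_inner_diff_right L2_diff)
    show ?thesis
      unfolding eq by (rule norm_triangle_mono[OF norm_triangle_mono[OF cs(1,2)] cs(3)])
  qed
  moreover have "(\<lambda>n. ?d n * ?e n + ?d n * L2_norm M g' + L2_norm M f' * ?e n)
      \<longlonglongrightarrow> 0 * 0 + 0 * L2_norm M g' + L2_norm M f' * 0"
    by (intro tendsto_intros assms)
  ultimately have "(\<lambda>n. L2_inner M (f n) (g n) - L2_inner M f' g') \<longlonglongrightarrow> 0"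
    by (intro Lim_null_comparison[where f="\<lambda>n. L2_inner M (f n) (g n) - L2_inner M f' g'"
          and g="\<lambda>n. ?d n * ?e n + ?d n * L2_norm M g' + L2_norm M f' * ?e n"] always_eventually allI)
      simp_all
  then show ?thesis
    by (simp add: LIM_zero_iff)
qed

lemma L2_norm_tendsto:
  assumes "\<And>n. f n \<in> L2 M" "f' \<in> L2 M" "(\<lambda>n. L2_norm M (\<lambda>x. f n x - f' x)) \<longlonglongrightarrow> 0"
  shows "(\<lambda>n. L2_norm M (f n)) \<longlonglongrightarrow> L2_norm M f'"
proof -
  have "(\<lambda>n. Re (L2_inner M (f n) (f n))) \<longlonglongrightarrow> Re (L2_inner M f' f')"
    by (intro tendsto_Re L2_inner_tendsto assms)
  then have "(\<lambda>n. sqrt ((L2_norm M (f n))\<^sup>2)) \<longlonglongrightarrow> sqrt ((L2_norm M f')\<^sup>2)"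
    by (intro tendsto_real_sqrt) (simp add: L2_inner_self)
  then show ?thesis
    by simp
qed

text \<open>The Riesz-Fischer theorem. A subsequence with geometrically small steps converges almost
  everywhere, and Fatou's lemma turns the Cauchy estimate of the whole sequence into norm
  convergence to that pointwise limit.\<close>

lemma L2_complete:
  assumes f: "\<And>n. f n \<in> L2 M"
    and Cauchy: "\<And>e. e > 0 \<Longrightarrow> \<exists>N. \<forall>m\<ge>N. \<forall>n\<ge>N. L2_norm M (\<lambda>x. f m x - f n x) < e"
  obtains g where "g \<in> L2 M" "(\<lambda>n. L2_norm M (\<lambda>x. f n x - g x)) \<longlonglongrightarrow> 0"
proof -
  have [measurable]: "f n \<in> borel_measurable M" for n
    using f by (rule L2_measurable)
  have "\<exists>N. \<forall>m\<ge>N. \<forall>n\<ge>N. L2_norm M (\<lambda>x. f m x - f n x) < (1/2)^k" for k :: nat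
    by (rule Cauchy) simp
  then obtain N where N: "\<And>k m n. m \<ge> N k \<Longrightarrow> n \<ge> N k \<Longrightarrow> L2_norm M (\<lambda>x. f m x - f n x) < (1/2)^k"
    by metis
  define r where "r k = (\<Sum>i\<le>k. N i)" for k \<comment> \<open>dominates \<open>N 0, \<dots>, N k\<close>\<close>
  have r: "N k \<le> r j" if "k \<le> j" for k j
    unfolding r_def using that by (intro member_le_sum) auto
  define d where "d k = (\<lambda>x. f (r (Suc k)) x - f (r k) x)" for k
  have d_L2: "d k \<in> L2 M" for k
    unfolding d_def by (intro L2_diff f)
  have [measurable]: "d k \<in> borel_measurable M" for k
    using d_L2 by (rule L2_measurable)
  have d_norm: "2^k * (L2_norm M (d k))\<^sup>2 \<le> (1/2)^k" for k
  proof -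
    have "L2_norm M (d k) \<le> (1/2)^k"
      unfolding d_def using N[of k "r (Suc k)" "r k"] r[of k] by auto
    then have "(L2_norm M (d k))\<^sup>2 \<le> ((1/2)^k)\<^sup>2"
      by (intro power_mono) auto
    then have "2^k * (L2_norm M (d k))\<^sup>2 \<le> 2^k * ((1/2)^k)\<^sup>2"
      by simp
    also have "2^k * ((1/2)^k)\<^sup>2 = (1/2::real)^k"
      by (simp add: power2_eq_square power_one_over)
    finally show ?thesis .
  qed
  \<comment> \<open>On a space of infinite measure \<open>\<Sum>k. \<bar>d k\<bar>\<close> need not be integrable; the weighted sum of squares is,
    and \<open>\<bar>d\<bar> \<le> 2\<^sup>k \<bar>d\<bar>\<^sup>2 + 2\<^sup>-\<^sup>k\<close> still gives pointwise absolute convergence.\<close>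
  have "(\<integral>\<^sup>+x. (\<Sum>k. ennreal (2^k * (cmod (d k x))\<^sup>2)) \<partial>M) = (\<Sum>k. \<integral>\<^sup>+x. ennreal (2^k * (cmod (d k x))\<^sup>2) \<partial>M)"
    by (rule nn_integral_suminf) measurable
  also have "\<dots> = (\<Sum>k. ennreal (2^k * (L2_norm M (d k))\<^sup>2))"
    using nn_integral_L2[OF d_L2] by (simp add: ennreal_mult nn_integral_cmult)
  also have "\<dots> \<le> (\<Sum>k. ennreal ((1/2)^k))"
    by (intro suminf_le summableI ennreal_leI d_norm)
  also have "\<dots> = ennreal (\<Sum>k. (1/2)^k)"
    by (rule suminf_ennreal2) (auto intro: summable_geometric)
  also have "\<dots> < \<infinity>"
    by simp
  finally have "(\<integral>\<^sup>+x. (\<Sum>k. ennreal (2^k * (cmod (d k x))\<^sup>2)) \<partial>M) \<noteq> \<infinity>"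
    by simp
  then have "AE x in M. (\<Sum>k. ennreal (2^k * (cmod (d k x))\<^sup>2)) \<noteq> \<infinity>"
    by (intro nn_integral_noteq_infinite) auto
  then have conv: "AE x in M. convergent (\<lambda>k. f (r k) x)"
  proof eventually_elim
    case (elim x)
    then have "summable (\<lambda>k. 2^k * (cmod (d k x))\<^sup>2)"
      by (intro summable_suminf_not_top) auto
    then have major: "summable (\<lambda>k. 2^k * (cmod (d k x))\<^sup>2 + (1/2)^k)"
      by (intro summable_add summable_geometric) auto
    have "norm (cmod (d k x)) \<le> 2^k * (cmod (d k x))\<^sup>2 + (1/2)^k" for k
    proof -
      let ?t = "2^k * cmod (d k x)"
      have "2 * ?t * 1 \<le> ?t\<^sup>2 + 1\<^sup>2"
        by (rule sum_squares_bound)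
      moreover have "0 \<le> ?t"
        by simp
      ultimately have "?t \<le> ?t\<^sup>2 + 1"
        unfolding mult_1_right one_power2 by linarith
      also have "\<dots> = 2^k * (2^k * (cmod (d k x))\<^sup>2 + (1/2)^k)"
        by (simp add: power2_eq_square power_one_over field_simps)
      finally show ?thesis
        by simp
    qed
    then have "summable (\<lambda>k. cmod (d k x))"
      by (rule summable_comparison_test'[OF major, of 0])
    then have "convergent (\<lambda>k. \<Sum>i<k. d i x)"
      using summable_norm_cancel[of "\<lambda>k. d k x"] by (simp add: summable_iff_convergent)
    moreover have "(\<Sum>i<k. d i x) = f (r k) x - f (r 0) x" for k
      unfolding d_def by (rule sum_lessThan_telescope)
    ultimately have "convergent (\<lambda>k. f (r k) x - f (r 0) x)"
      by simp
    then show ?case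
      using convergent_diff_const_right_iff by blast
  qed
  define g where "g x = lim (\<lambda>k. f (r k) x)" for x
  have [measurable]: "g \<in> borel_measurable M"
    unfolding g_def by measurable
  have bound: "(\<integral>\<^sup>+x. ennreal ((cmod (f n x - g x))\<^sup>2) \<partial>M) \<le> ennreal (((1/2)^k)\<^sup>2)" if n: "n \<ge> N k" for n k
  proof -
    have "(\<integral>\<^sup>+x. ennreal ((cmod (f n x - g x))\<^sup>2) \<partial>M)
        = (\<integral>\<^sup>+x. liminf (\<lambda>j. ennreal ((cmod (f n x - f (r j) x))\<^sup>2)) \<partial>M)"
    proof (rule nn_integral_cong_AE, use conv in eventually_elim)
      case (elim x)
      then have "(\<lambda>j. f (r j) x) \<longlonglongrightarrow> g x"
        by (simp add: g_def convergent_LIMSEQ_iff)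
      then have "(\<lambda>j. ennreal ((cmod (f n x - f (r j) x))\<^sup>2)) \<longlonglongrightarrow> ennreal ((cmod (f n x - g x))\<^sup>2)"
        by (intro tendsto_intros tendsto_ennrealI)
      then show ?case
        by (rule lim_imp_Liminf[OF sequentially_bot, symmetric])
    qed
    also have "\<dots> \<le> liminf (\<lambda>j. \<integral>\<^sup>+x. ennreal ((cmod (f n x - f (r j) x))\<^sup>2) \<partial>M)"
      by (rule nn_integral_liminf) measurable
    also have "\<dots> \<le> ennreal (((1/2)^k)\<^sup>2)"
    proof (rule Liminf_le)
      have "(\<integral>\<^sup>+x. ennreal ((cmod (f n x - f (r j) x))\<^sup>2) \<partial>M) \<le> ennreal (((1/2)^k)\<^sup>2)" if "j \<ge> k" for j
        unfolding nn_integral_L2[OF L2_diff[OF f f]]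
        using N[OF n r[OF that]] by (intro ennreal_leI power_mono) auto
      then show "\<forall>\<^sub>F j in sequentially. (\<integral>\<^sup>+x. ennreal ((cmod (f n x - f (r j) x))\<^sup>2) \<partial>M) \<le> ennreal (((1/2)^k)\<^sup>2)"
        by (auto simp: eventually_sequentially)
    qed simp
    finally show ?thesis .
  qed
  have diff_L2: "(\<lambda>x. f n x - g x) \<in> L2 M" if "n \<ge> N 0" for n
    unfolding L2_iff_nn_integral using bound[OF that] by (auto intro: order_le_less_trans)
  have "g \<in> L2 M"
    using L2_diff[OF f[of "N 0"] diff_L2[OF order_refl]] by simp
  moreover have "(\<lambda>n. L2_norm M (\<lambda>x. f n x - g x)) \<longlonglongrightarrow> 0"
  proof (rule LIMSEQ_I)
    fix e :: real assume "e > 0"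
    then obtain k where k: "(1/2)^k < e"
      using real_arch_pow_inv[of e "1/2"] by auto
    have "norm (L2_norm M (\<lambda>x. f n x - g x) - 0) < e" if n: "n \<ge> N k" for n
    proof -
      have "(L2_norm M (\<lambda>x. f n x - g x))\<^sup>2 \<le> ((1/2)^k)\<^sup>2"
        using bound[OF n] nn_integral_L2[OF L2_diff[OF f \<open>g \<in> L2 M\<close>], of n] by (simp del: ennreal_power)
      then have "L2_norm M (\<lambda>x. f n x - g x) \<le> (1/2)^k"
        by (rule power2_le_imp_le) simp
      then show ?thesis
        using k by simp
    qed
    then show "\<exists>no. \<forall>n\<ge>no. norm (L2_norm M (\<lambda>x. f n x - g x) - 0) < e"
      by blast
  qed
  ultimately show ?thesis
    by (rule that)
qed

text \<open>Bessel's inequality makes the partial sums Cauchy, so they have a limit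
  \<open>g\<close>. By continuity of the inner product \<open>g\<close> has the same coefficients as
  \<open>f\<close>, and \<open>complete\<close> applied to \<open>f - g\<close> identifies the two
  almost everywhere.\<close>

lemma complete_orthonormal_Parseval:
  fixes u :: "nat \<Rightarrow> 'a \<Rightarrow> complex"
  assumes u: "\<And>k. u k \<in> L2 M"
    and ortho: "\<And>i j. L2_inner M (u i) (u j) = (if i = j then 1 else 0)"
    and complete: "\<And>h. h \<in> L2 M \<Longrightarrow> (\<And>k. L2_inner M (u k) h = 0) \<Longrightarrow> AE x in M. h x = 0"
    and f: "f \<in> L2 M"
  shows "(\<lambda>k. (cmod (L2_inner M (u k) f))\<^sup>2) sums (L2_norm M f)\<^sup>2"
proof -
  define c where "c k = L2_inner M (u k) f" for k
  define S where "S K = (\<lambda>x. \<Sum>k\<in>K. c k * u k x)" for K :: "nat set"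
  have S_L2: "S K \<in> L2 M" for K
    unfolding S_def by (intro L2_sum L2_cmult u)
  have inner_S: "L2_inner M h (S K) = (\<Sum>k\<in>K. c k * L2_inner M h (u k))" if "h \<in> L2 M" for h K
    unfolding S_def using that u by (simp add: L2_inner_sum_right L2_cmult L2_inner_cmult_right)
  have u_S: "L2_inner M (u j) (S K) = (if j \<in> K then c j else 0)" if "finite K" for j K
    using that by (simp add: inner_S[OF u] ortho if_distrib[where f="\<lambda>z. _ * z"] cong: if_cong)
  have norm_S: "(L2_norm M (S K))\<^sup>2 = (\<Sum>k\<in>K. (cmod (c k))\<^sup>2)" if "finite K" for K
  proof -
    have "L2_inner M (S K) (u k) = cnj (c k)" if "k \<in> K" for k
      using u_S[OF \<open>finite K\<close>, of k] that L2_inner_commute[of M "S K" "u k"] by simp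
    then have "L2_inner M (S K) (S K) = (\<Sum>k\<in>K. c k * cnj (c k))"
      unfolding inner_S[OF S_L2] by simp
    also have "\<dots> = complex_of_real (\<Sum>k\<in>K. (cmod (c k))\<^sup>2)"
      by (simp only: complex_norm_square[symmetric] of_real_sum)
    finally show ?thesis
      unfolding L2_inner_self of_real_eq_iff .
  qed
  have Bessel: "(\<Sum>k<n. (cmod (c k))\<^sup>2) \<le> (L2_norm M f)\<^sup>2" for n
  proof -
    have "L2_inner M f (u k) = cnj (c k)" for k
      unfolding c_def by (rule L2_inner_commute)
    then have "L2_inner M f (S {..<n}) = (\<Sum>k<n. c k * cnj (c k))"
      unfolding inner_S[OF f] by simp
    also have "\<dots> = complex_of_real (\<Sum>k<n. (cmod (c k))\<^sup>2)"
      by (simp only: complex_norm_square[symmetric] of_real_sum)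
    finally have "Re (L2_inner M f (S {..<n})) = (\<Sum>k<n. (cmod (c k))\<^sup>2)"
      by simp
    then show ?thesis
      using L2_norm_diff_power2[OF f S_L2, of "{..<n}"] norm_S[of "{..<n}"]
        zero_le_power2[of "L2_norm M (\<lambda>x. f x - S {..<n} x)"] by simp
  qed
  have summable: "summable (\<lambda>k. (cmod (c k))\<^sup>2)"
    by (rule summableI_nonneg_bounded[OF _ Bessel]) simp
  have S_diff: "L2_norm M (\<lambda>x. S {..<m} x - S {..<n} x) = sqrt (\<Sum>k\<in>{n..<m}. (cmod (c k))\<^sup>2)" if "n \<le> m" for m n
  proof -
    have split: "{..<m} = {..<n} \<union> {n..<m}"
      using that by auto
    have "S {..<m} x = S {..<n} x + S {n..<m} x" for x
      unfolding S_def split by (rule sum.union_disjoint) auto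
    then show ?thesis
      by (simp add: norm_S[symmetric])
  qed
  obtain g where g: "g \<in> L2 M" and lim: "(\<lambda>n. L2_norm M (\<lambda>x. S {..<n} x - g x)) \<longlonglongrightarrow> 0"
  proof (rule L2_complete[of "\<lambda>n. S {..<n}" M])
    fix e :: real assume "e > 0"
    then have "e\<^sup>2 > 0" by simp
    then obtain N where N: "\<And>m n. m \<ge> N \<Longrightarrow> norm (\<Sum>k\<in>{m..<n}. (cmod (c k))\<^sup>2) < e\<^sup>2"
      using summable unfolding summable_Cauchy by meson
    have *: "L2_norm M (\<lambda>x. S {..<m} x - S {..<n} x) < e" if "n \<ge> N" "n \<le> m" for m n
    proof -
      have "(\<Sum>k\<in>{n..<m}. (cmod (c k))\<^sup>2) < e\<^sup>2"
        using N[OF that(1), of m] by (simp add: sum_nonneg)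
      then show ?thesis
        unfolding S_diff[OF that(2)] using \<open>e > 0\<close> by (intro real_less_lsqrt) (auto intro: sum_nonneg)
    qed
    have "L2_norm M (\<lambda>x. S {..<m} x - S {..<n} x) < e" if "m \<ge> N" "n \<ge> N" for m n
      using *[of n m] *[of m n] that L2_norm_minus_commute[of M "S {..<m}" "S {..<n}"]
      by (cases "n \<le> m") auto
    then show "\<exists>N. \<forall>m\<ge>N. \<forall>n\<ge>N. L2_norm M (\<lambda>x. S {..<m} x - S {..<n} x) < e"
      by blast
  qed (use S_L2 in auto)
  have "L2_inner M (u j) g = c j" for j
  proof -
    have "(\<lambda>n. L2_inner M (u j) (S {..<n})) \<longlonglongrightarrow> L2_inner M (u j) g"
      using L2_inner_tendsto[where f="\<lambda>_. u j" and f'="u j" and g="\<lambda>n. S {..<n}" and g'=g and M=M] u S_L2 g lim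
      by (simp add: L2_norm_def)
    moreover have "\<forall>\<^sub>F n in sequentially. L2_inner M (u j) (S {..<n}) = c j"
      using eventually_gt_at_top[of j] by eventually_elim (simp add: u_S)
    ultimately have "(\<lambda>n. c j) \<longlonglongrightarrow> L2_inner M (u j) g"
      by (rule Lim_transform_eventually)
    then show ?thesis
      by (simp add: LIMSEQ_const_iff)
  qed
  then have "L2_inner M (u k) (\<lambda>x. f x - g x) = 0" for k
    by (simp add: L2_inner_diff_right u f g c_def)
  then have "AE x in M. f x - g x = 0"
    using complete[OF L2_diff[OF f g]] by blast
  then have "L2_norm M f = L2_norm M g"
    using f g by (intro L2_norm_cong_AE) (auto simp: L2_measurable)
  moreover have "(\<lambda>n. (L2_norm M (S {..<n}))\<^sup>2) \<longlonglongrightarrow> (L2_norm M g)\<^sup>2"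
    by (intro tendsto_power L2_norm_tendsto S_L2 g lim)
  ultimately show ?thesis
    by (simp add: sums_def norm_S c_def)
qed

text \<open>Bridge from Tonelli computations, where a sum is an integral over the counting measure,
  to the unconditional sum in \<open>tight_frame\<close>.\<close>

lemma has_sum_of_nn_integral_count_space:
  fixes f :: "'a \<Rightarrow> real"
  assumes "\<And>x. f x \<ge> 0" and S: "(\<integral>\<^sup>+x. ennreal (f x) \<partial>count_space UNIV) = ennreal S" and "S \<ge> 0"
  shows "(f has_sum S) UNIV"
proof -
  have int: "integrable (count_space UNIV) f"
    using assms(1) S by (intro integrableI_nonneg) auto
  then have "infsetsum f UNIV = S"
    unfolding infsetsum_def using assms by (subst integral_eq_nn_integral) auto
  moreover have "Infinite_Set_Sum.abs_summable_on f UNIV"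
    using int by (simp add: abs_summable_on_def)
  ultimately show ?thesis
    by (metis abs_summable_equivalent abs_summable_summable has_sum_infsum infsetsum_infsum)
qed

lemma nn_integral_count_space_of_sums:
  fixes f :: "nat \<Rightarrow> real"
  assumes "f sums S" "\<And>k. f k \<ge> 0"
  shows "(\<integral>\<^sup>+k. ennreal (f k) \<partial>count_space UNIV) = ennreal S"
  using assms by (simp add: nn_integral_count_space_nat sums_iff suminf_ennreal2)

lemma nn_integral_count_space_of_has_sum:
  fixes f :: "'a::countable \<Rightarrow> real"
  assumes "(f has_sum S) UNIV" "\<And>x. f x \<ge> 0"
  shows "(\<integral>\<^sup>+x. ennreal (f x) \<partial>count_space UNIV) = ennreal S"
proof -
  have "Infinite_Set_Sum.abs_summable_on f UNIV"
    using assms abs_summable_equivalent summable_on_iff_abs_summable_on_real has_sum_imp_summable by blast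
  then have "integrable (count_space UNIV) f" "infsetsum f UNIV = S"
    using assms infsetsum_infsum[of f UNIV] infsumI[of f UNIV S] by (auto simp: abs_summable_on_def)
  then show ?thesis
    using assms(2) by (simp add: nn_integral_eq_integral infsetsum_def)
qed

section \<open>Fourier series on an interval\<close>

text \<open>The test functions are bounded functions of the circle variable, so integrability is the
  natural requirement. Localisation to one period enters only when circle functions must separate
  points of the line.\<close>

definition trig_annihilator :: "real \<Rightarrow> (real \<Rightarrow> complex) set" where
  "trig_annihilator D = {f. integrable lborel f \<and>
     (\<forall>m::int. (LINT x|lborel. f x * cis (2 * pi * of_int m * x / D)) = 0)}"

lemma integrable_mult_bounded:
  fixes f g :: "'a \<Rightarrow> complex"
  assumes f: "integrable M f" and [measurable]: "g \<in> borel_measurable M" and g: "\<And>x. cmod (g x) \<le> B"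
  shows "integrable M (\<lambda>x. f x * g x)"
proof -
  have [measurable]: "f \<in> borel_measurable M"
    using f by auto
  have int: "integrable M (\<lambda>x. B * cmod (f x))"
    using f by auto
  have le: "cmod (f x * g x) \<le> norm (B * cmod (f x))" for x
    using mult_left_mono[OF g[of x], of "cmod (f x)"] by (simp add: norm_mult mult.commute)
  show ?thesis
    by (rule Bochner_Integration.integrable_bound[OF int]) (measurable, intro always_eventually allI le)
qed

lemma borel_measurable_cis [measurable (raw)]:
  assumes "f \<in> borel_measurable M"
  shows "(\<lambda>x. cis (f x)) \<in> borel_measurable M"
  by (rule borel_measurable_continuous_on[OF _ assms]) (intro continuous_intros)

lemma trig_annihilatorD:
  assumes "f \<in> trig_annihilator D"
  shows "integrable lborel f" "(LINT x|lborel. f x * cis (2 * pi * of_int m * x / D)) = 0"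
  using assms by (auto simp: trig_annihilator_def)

lemma trig_annihilator_cis:
  assumes "f \<in> trig_annihilator D"
  shows "(\<lambda>x. f x * (c * cis (2 * pi * of_int k * x / D))) \<in> trig_annihilator D"
proof -
  have add: "2 * pi * of_int k * x / D + 2 * pi * of_int m * x / D = 2 * pi * of_int (k + m) * x / D" for x m
    by (simp add: add_divide_distrib distrib_left distrib_right)
  have "f x * (c * cis (2 * pi * of_int k * x / D)) * cis (2 * pi * of_int m * x / D)
      = c * (f x * cis (2 * pi * of_int (k + m) * x / D))" for x m
    unfolding add[symmetric] cis_mult[symmetric] by (simp only: mult_ac)
  then have "(LINT x|lborel. f x * (c * cis (2 * pi * of_int k * x / D)) * cis (2 * pi * of_int m * x / D)) = 0" for m
    using trig_annihilatorD(2)[OF assms, of "k + m"] by (simp only: integral_mult_right_zero mult_zero_right)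
  moreover have "integrable lborel (\<lambda>x. f x * (c * cis (2 * pi * of_int k * x / D)))"
    using trig_annihilatorD(1)[OF assms] by (rule integrable_mult_bounded[where B="cmod c"]) (auto simp: norm_mult)
  ultimately show ?thesis
    by (simp add: trig_annihilator_def)
qed

lemma trig_annihilator_add:
  assumes "f \<in> trig_annihilator D" "g \<in> trig_annihilator D"
  shows "(\<lambda>x. f x + g x) \<in> trig_annihilator D"
proof -
  have "integrable lborel (\<lambda>x. h x * cis (2 * pi * of_int m * x / D))" if "h \<in> trig_annihilator D" for h m
    using trig_annihilatorD(1)[OF that] by (rule integrable_mult_bounded[where B=1]) auto
  then show ?thesis
    using assms by (simp add: trig_annihilator_def distrib_right)
qed

text \<open>
  Quantifying over all annihilated \<open>f\<close>, instead of expanding \<open>p\<close> into a trigonometric sum, makes the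
  product case of the induction immediate.
\<close>

lemma trig_annihilator_polynomial:
  assumes "real_polynomial_function p" "f \<in> trig_annihilator D"
  shows "(\<lambda>x. f x * complex_of_real (p (cis (2 * pi * x / D)))) \<in> trig_annihilator D"
  using assms
proof (induction arbitrary: f)
  case (linear p)
  interpret bounded_linear p by fact
  let ?e = "\<lambda>k x. cis (2 * pi * of_int k * x / D)"
  \<comment> \<open>A real-linear functional on the plane, restricted to the circle, is a
    combination of \<open>cis t\<close> and \<open>cis (- t)\<close>; these are its two Fourier
    coefficients, so multiplication by it only shifts frequencies by one.\<close>
  let ?c = "(p 1 - \<i> * p \<i>) / 2" and ?d = "(p 1 + \<i> * p \<i>) / 2"
  have eq: "complex_of_real (p (cis t)) = ?c * cis t + ?d * cis (- t)" for t
  proof -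
    have "cis t = cos t *\<^sub>R 1 + sin t *\<^sub>R \<i>"
      by (simp add: complex_eq_iff)
    then have "p (cis t) = cos t * p 1 + sin t * p \<i>"
      by (simp only: add scaleR real_scaleR_def)
    then show ?thesis
      by (simp add: complex_eq_iff field_simps)
  qed
  have "f x * complex_of_real (p (cis (2 * pi * x / D))) = f x * (?c * ?e 1 x) + f x * (?d * ?e (-1) x)" for x
    unfolding eq distrib_left by simp
  then show ?case
    using trig_annihilator_add[OF trig_annihilator_cis[OF linear.prems, of ?c 1]
      trig_annihilator_cis[OF linear.prems, of ?d "-1"]] by simp
next
  case (const c)
  show ?case
    using trig_annihilator_cis[OF const, of "complex_of_real c" 0] by simp
next
  case (add p q)
  show ?case
    using trig_annihilator_add[OF add.IH(1)[OF add.prems] add.IH(2)[OF add.prems]] by (simp add: distrib_left)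
next
  case (mult p q)
  show ?case
    using mult.IH(2)[OF mult.IH(1)[OF mult.prems]] by (simp add: mult.assoc)
qed

text \<open>On the unit circle \<open>g\<close> is within \<open>d\<close> of a real polynomial
  \<open>p\<close>, whose pairing with \<open>f\<close> vanishes. The error is at most
  \<open>d\<close> times the L1 norm of \<open>f\<close>, and \<open>d\<close> is arbitrary.\<close>

lemma trig_annihilator_continuous:
  assumes f: "f \<in> trig_annihilator D" and g: "continuous_on UNIV g"
  shows "(LINT x|lborel. f x * complex_of_real (g (cis (2 * pi * x / D)))) = 0"
proof -
  let ?e = "\<lambda>x. cis (2 * pi * x / D)"
  have [measurable]: "g \<in> borel_measurable borel"
    by (rule borel_measurable_continuous_onI[OF g])
  have "compact (sphere (0::complex) 1)"
    by simp
  then have "bounded (g ` sphere 0 1)"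
    using g by (intro compact_imp_bounded compact_continuous_image) (auto intro: continuous_on_subset)
  then obtain B where B: "\<And>x. \<bar>g (?e x)\<bar> \<le> B"
    unfolding bounded_iff by (metis image_eqI norm_cis mem_sphere_0 real_norm_def)
  have int_g: "integrable lborel (\<lambda>x. f x * complex_of_real (g (?e x)))"
    using trig_annihilatorD(1)[OF f] by (rule integrable_mult_bounded[where B=B]) (use B in auto)
  let ?I = "LINT x|lborel. f x * complex_of_real (g (?e x))" and ?N = "LINT x|lborel. cmod (f x)"
  have "cmod ?I \<le> d * ?N" if d: "d > 0" for d
  proof -
    obtain p where p: "real_polynomial_function p" "\<And>z. z \<in> sphere 0 1 \<Longrightarrow> \<bar>g z - p z\<bar> < d"
      using Stone_Weierstrass_real_polynomial_function[OF compact_sphere continuous_on_subset[OF g subset_UNIV] d]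
      by blast
    note P = trig_annihilator_polynomial[OF p(1) f]
    have "?I = (LINT x|lborel. f x * complex_of_real (g (?e x)) - f x * complex_of_real (p (?e x)))"
      using trig_annihilatorD(2)[OF P, of 0] trig_annihilatorD(1)[OF P] int_g by simp
    also have "\<dots> = (LINT x|lborel. f x * complex_of_real (g (?e x) - p (?e x)))"
      by (simp add: right_diff_distrib)
    finally have "cmod ?I \<le> (LINT x|lborel. cmod (f x * complex_of_real (g (?e x) - p (?e x))))"
      by (simp only: integral_norm_bound)
    also have "\<dots> \<le> (LINT x|lborel. d * cmod (f x))"
    proof (rule integral_mono)
      show "integrable lborel (\<lambda>x. cmod (f x * complex_of_real (g (?e x) - p (?e x))))"
        using Bochner_Integration.integrable_diff[OF int_g trig_annihilatorD(1)[OF P]]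
        by (simp add: right_diff_distrib)
      show "integrable lborel (\<lambda>x. d * cmod (f x))"
        using trig_annihilatorD(1)[OF f] by auto
      show "cmod (f x * complex_of_real (g (?e x) - p (?e x))) \<le> d * cmod (f x)" for x
        using mult_right_mono[OF less_imp_le[OF p(2)[of "?e x"]], of "cmod (f x)"]
        by (simp add: norm_mult mult.commute flip: of_real_diff)
    qed
    finally show ?thesis
      by simp
  qed
  then have "\<forall>\<^sub>F d in at_right 0. cmod ?I \<le> d * ?N"
    by (intro eventually_at_right_less[THEN eventually_mono])
  moreover have "((\<lambda>d. d * ?N) \<longlongrightarrow> 0 * ?N) (at_right 0)"
    by (rule tendsto_mult_right) (rule tendsto_ident_at)
  ultimately have "cmod ?I \<le> 0 * ?N"
    by (intro tendsto_lowerbound[where F="at_right 0" and f="\<lambda>d. d * ?N"]) simp_all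
  then show ?thesis
    by simp
qed

text \<open>The indicator of \<open>C\<close> is the pointwise limit of the tent functions
  \<open>g k\<close>, which are bounded by 1, so dominated convergence applies. \<open>C\<close>
  must be nonempty here because \<open>infdist z {}\<close> is 0 by convention, and the tents would
  then be constantly 1.\<close>

lemma trig_annihilator_closed:
  assumes f: "f \<in> trig_annihilator D" and C: "closed C" "C \<noteq> {}"
  shows "(LINT x|lborel. f x * indicator C (cis (2 * pi * x / D))) = 0"
proof -
  let ?e = "\<lambda>x. cis (2 * pi * x / D)"
  define g where "g k z = max 0 (1 - real k * infdist z C)" for k and z :: complex
  have g: "continuous_on UNIV (g k)" for k
    unfolding g_def by (intro continuous_intros)
  have [measurable]: "g k \<in> borel_measurable borel" for k
    by (rule borel_measurable_continuous_onI[OF g])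
  have [measurable]: "C \<in> sets borel"
    using C by simp
  have [measurable]: "f \<in> borel_measurable borel"
    using trig_annihilatorD(1)[OF f] by auto
  have lim: "(\<lambda>k. complex_of_real (g k z)) \<longlonglongrightarrow> indicator C z" for z
  proof (cases "z \<in> C")
    case True
    then show ?thesis
      by (simp add: g_def)
  next
    case False
    then have "infdist z C > 0"
      using C infdist_pos_not_in_closed by blast
    then obtain n :: nat where n: "1 < real n * infdist z C"
      using reals_Archimedean3 by blast
    have "g k z = 0" if "k \<ge> n" for k
    proof -
      have "real n * infdist z C \<le> real k * infdist z C"
        using that by (intro mult_right_mono) (auto simp: infdist_nonneg)
      then show ?thesis
        using n by (simp add: g_def)
    qed
    then have "\<forall>\<^sub>F k in sequentially. complex_of_real (g k z) = indicator C z"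
      using False by (auto simp: eventually_sequentially)
    then show ?thesis
      by (rule tendsto_eventually)
  qed
  have "(\<lambda>k. LINT x|lborel. f x * complex_of_real (g k (?e x))) \<longlonglongrightarrow> (LINT x|lborel. f x * indicator C (?e x))"
  proof (rule integral_dominated_convergence[where w="\<lambda>x. cmod (f x)"])
    show "AE x in lborel. (\<lambda>k. f x * complex_of_real (g k (?e x))) \<longlonglongrightarrow> f x * indicator C (?e x)"
      by (intro always_eventually allI tendsto_mult_left lim)
    show "AE x in lborel. cmod (f x * complex_of_real (g k (?e x))) \<le> cmod (f x)" for k
    proof (intro always_eventually allI)
      fix x
      have "\<bar>g k (?e x)\<bar> \<le> 1"
        by (simp add: g_def infdist_nonneg)
      then show "cmod (f x * complex_of_real (g k (?e x))) \<le> cmod (f x)"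
        using mult_left_mono[of "\<bar>g k (?e x)\<bar>" 1 "cmod (f x)"] by (simp add: norm_mult)
    qed
  qed (use trig_annihilatorD(1)[OF f] in auto)
  then show ?thesis
    unfolding trig_annihilator_continuous[OF f g] by (simp add: LIMSEQ_const_iff)
qed

text \<open>A function whose integral over every Borel set vanishes is null, and intervals generate
  the Borel sets. Within one period an interval is, up to the two endpoints, the preimage of a
  closed arc under the exponential.\<close>

lemma trig_annihilator_eq_0:
  assumes D: "D > 0" and f: "f \<in> trig_annihilator D" and supp: "\<And>x. x \<notin> {a..a + D} \<Longrightarrow> f x = 0"
  shows "AE x in lborel. f x = 0"
proof (rule sigma_finite_measure.density_zero[OF sigma_finite_lborel])
  show int: "integrable lborel f"
    by (rule trig_annihilatorD(1)[OF f])
  have [measurable]: "f \<in> borel_measurable borel"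
    using int by auto
  have total: "(LINT x|lborel. f x) = 0"
    using trig_annihilatorD(2)[OF f, of 0] by simp
  let ?e = "\<lambda>x. cis (2 * pi * x / D)"
  \<comment> \<open>The exponential identifies \<open>a\<close> with \<open>a + D\<close>.
    Injectivity therefore keeps one argument in the open period, which makes the distance strictly
    less than \<open>D\<close>.\<close>
  have inj: "x = y" if "?e x = ?e y" "x \<in> {a<..<a + D}" "y \<in> {a..a + D}" for x y
  proof -
    obtain n where n: "2 * pi * x / D = 2 * pi * y / D + 2 * pi * of_int n"
      using \<open>?e x = ?e y\<close> sin_cos_eq_iff[of "2 * pi * x / D" "2 * pi * y / D"] by (auto simp: complex_eq_iff)
    then have "2 * pi * (x - y) = 2 * pi * (of_int n * D)"
      using D by (simp add: field_simps)
    then have "x - y = of_int n * D"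
      by simp
    moreover have "\<bar>x - y\<bar> < D"
      using that(2,3) by auto
    ultimately have "\<bar>real_of_int n\<bar> * D < 1 * D"
      using D by (simp add: abs_mult)
    then have "\<bar>real_of_int n\<bar> < 1"
      using D by (simp only: mult_less_cancel_right_pos)
    then have "n = 0"
      by linarith
    then show "x = y"
      using \<open>x - y = of_int n * D\<close> by simp
  qed
  have Icc: "(LINT x:{s..t}|lborel. f x) = 0" for s t
  proof (cases "max s a \<le> min t (a + D)")
    case False
    then have "indicator {s..t} x *\<^sub>R f x = 0" for x
      using supp[of x] by (auto simp: indicator_def)
    then show ?thesis
      by (simp only: set_lebesgue_integral_def Bochner_Integration.integral_zero)
  next
    case True
    \<comment> \<open>Clipping to one period gives a compact interval, so its arc \<open>?C\<close>
      is closed; outside the period \<open>f\<close> vanishes anyway.\<close>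
    let ?J = "{max s a..min t (a + D)}"
    let ?C = "?e ` ?J"
    have "compact ?C"
      using D by (intro compact_continuous_image continuous_intros) auto
    then have C: "closed ?C"
      by (rule compact_imp_closed)
    then have [measurable]: "?C \<in> sets borel"
      by simp
    have eq: "f x * indicator ?C (?e x) = indicator {s..t} x *\<^sub>R f x" if "x \<noteq> a" "x \<noteq> a + D" for x
    proof (cases "x \<in> {a<..<a + D}")
      case True
      then have "?e x \<in> ?C \<longleftrightarrow> x \<in> {s..t}"
        using inj[OF _ True] by (fastforce simp: image_iff)
      then show ?thesis
        by (auto simp: indicator_def)
    next
      case False
      then show ?thesis
        using supp[of x] that by auto
    qed
    have "AE x in lborel. f x * indicator ?C (?e x) = indicator {s..t} x *\<^sub>R f x"
      using AE_lborel_singleton[of a] AE_lborel_singleton[of "a + D"] by eventually_elim (rule eq)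
    then have int_eq: "(LINT x|lborel. f x * indicator ?C (?e x)) = (LINT x|lborel. indicator {s..t} x *\<^sub>R f x)"
      by (intro integral_cong_AE) auto
    have "?C \<noteq> {}"
      using True by simp
    from trans[OF int_eq[symmetric] trig_annihilator_closed[OF f C this]] show ?thesis
      unfolding set_lebesgue_integral_def .
  qed
  fix A :: "real set" assume "A \<in> sets lborel"
  then have "A \<in> sets borel"
    by simp
  then show "(LINT x:A|lborel. f x) = 0"
  proof (induction rule: borel_set_induct)
    case empty
    show ?case
      by (simp add: set_lebesgue_integral_def)
  next
    case (interval a b)
    show ?case
      by (rule Icc)
  next
    \<comment> \<open>Complements need the integral over the whole line to vanish, which is the
      annihilation at frequency 0.\<close>
    case (compl A)
    note [measurable] = compl.hyps
    have "indicator (- A) x *\<^sub>R f x = f x - indicator A x *\<^sub>R f x" for x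
      by (auto simp: indicator_def)
    then show ?case
      using compl total int integrable_mult_indicator[OF _ int, of A] by (simp add: set_lebesgue_integral_def)
  next
    case (union A)
    note [measurable] = union.hyps
    have "(LINT x:(\<Union>i. A i)|lborel. f x) = (\<Sum>i. (LINT x:(A i)|lborel. f x))"
    proof (rule lebesgue_integral_countable_add)
      show "set_integrable lborel (\<Union>i. A i) f"
        unfolding set_integrable_def by (intro integrable_mult_indicator int) measurable
    qed (use union in \<open>auto simp: disjoint_family_on_def\<close>)
    then show ?case
      using union by simp
  qed
qed

section \<open>Orthonormality of the exponentials and Parseval on an interval\<close>

lemma integral_cis_period:
  assumes D: "D > 0"
  shows "(LINT x|lborel. indicator {a..a + D} x *\<^sub>R cis (2 * pi * of_int k * x / D))
    = (if k = 0 then complex_of_real D else 0)"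
proof (cases "k = 0")
  case True
  then show ?thesis
    using D by (simp add: scaleR_conv_of_real)
next
  case False
  define w where "w = 2 * pi * of_int k / D"
  have w: "w \<noteq> 0"
    using False D by (simp add: w_def)
  let ?F = "\<lambda>x. - \<i> / w * cis (w * x)"
  have "(LINT x|lborel. indicator {a..a + D} x *\<^sub>R cis (w * x)) = ?F (a + D) - ?F a"
  proof (rule integral_FTC_Icc)
    have "((\<lambda>x. cis (w * x)) has_vector_derivative (w *\<^sub>R (\<i> * cis (w * x)))) (at x within {a..a + D})" for x
    proof -
      have "((\<lambda>z. exp (\<i> * (w * z))) has_field_derivative (w * (\<i> * cis (w * x)))) (at (complex_of_real x))"
        unfolding cis_conv_exp by (auto intro!: derivative_eq_intros)
      then show ?thesis
        by (auto dest!: has_vector_derivative_real_field intro: has_vector_derivative_at_within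
            simp: cis_conv_exp scaleR_conv_of_real)
    qed
    from has_vector_derivative_mult_right[OF this, of "- \<i> / w"]
    show "(?F has_vector_derivative cis (w * x)) (at x within {a..a + D})" for x
      using w by (simp add: scaleR_conv_of_real)
  qed (use D in \<open>auto intro!: continuous_intros\<close>)
  also have "cis (w * (a + D)) = cis (w * a)"
  proof -
    have "w * (a + D) = w * a + 2 * pi * of_int k"
      using D by (simp add: w_def field_simps)
    then show ?thesis
      by (simp add: complex_eq_iff sin_cos_eq_iff[of "w * a + 2 * pi * of_int k" "w * a", THEN iffD2, THEN conjunct1]
        sin_cos_eq_iff[of "w * a + 2 * pi * of_int k" "w * a", THEN iffD2, THEN conjunct2])
  qed
  finally show ?thesis
    using False by (simp add: w_def)
qed

text \<open>The coefficients here are unnormalised; in the orthonormal system each is divided by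
  \<open>sqrt D\<close>, which accounts for the factor \<open>D\<close>. The interval may start at
  any \<open>a\<close>, as both the support after the substitution and the one in Plancherel's
  theorem require.\<close>

lemma Fourier_series_Parseval:
  assumes D: "D > 0" and f: "f \<in> L2 lborel" and supp: "\<And>x. x \<notin> {a..a + D} \<Longrightarrow> f x = 0"
  shows "(\<integral>\<^sup>+m. ennreal ((cmod (LINT x|lborel. f x * cis (- (2 * pi * of_int m * x / D))))\<^sup>2) \<partial>count_space (UNIV :: int set))
    = ennreal D * (\<integral>\<^sup>+x. ennreal ((cmod (f x))\<^sup>2) \<partial>lborel)"
proof -
  let ?J = "{a..a + D}"
  \<comment> \<open>A density, rather than a restricted space, keeps all functions on the whole line
    while null sets of \<open>M\<close> see only the interval.\<close>
  define M where "M = density lborel (\<lambda>x. ennreal (indicator ?J x))"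
  define c where "c m = (LINT x|lborel. f x * cis (- (2 * pi * of_int m * x / D)))" for m :: int
  define u where "u k = (\<lambda>x. complex_of_real (1 / sqrt D) * cis (2 * pi * of_int (int_decode k) * x / D))" for k
  have [measurable]: "f \<in> borel_measurable borel"
    using f by (simp add: L2_def)
  have sets_M [measurable_cong, simp]: "sets M = sets borel"
    by (simp add: M_def)
  have u_meas [measurable]: "u k \<in> borel_measurable borel" for k
    unfolding u_def by measurable
  have integral_M: "integral\<^sup>L M h = (LINT x|lborel. indicator ?J x *\<^sub>R h x)" if "h \<in> borel_measurable borel" for h :: "real \<Rightarrow> complex"
    unfolding M_def using that by (intro integral_density) auto
  have nn_integral_M: "integral\<^sup>N M h = (\<integral>\<^sup>+x. ennreal (indicator ?J x) * h x \<partial>lborel)" if "h \<in> borel_measurable borel" for h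
    unfolding M_def using that by (intro nn_integral_density) auto
  have supp': "indicator ?J x *\<^sub>R f x = f x" for x
    using supp[of x] by (auto simp: indicator_def)
  have bounded_L2: "h \<in> L2 M" if "h \<in> borel_measurable borel" "\<And>x. cmod (h x) \<le> B" for h B
  proof -
    have [measurable]: "h \<in> borel_measurable borel" by fact
    have "(\<integral>\<^sup>+x. ennreal ((cmod (h x))\<^sup>2) \<partial>M) \<le> (\<integral>\<^sup>+x. ennreal (B\<^sup>2) * indicator ?J x \<partial>lborel)"
      using that(2) by (subst nn_integral_M)
        (auto intro!: nn_integral_mono ennreal_leI power_mono simp: indicator_def)
    also have "\<dots> < \<infinity>"
      using D by (simp add: nn_integral_cmult_indicator ennreal_mult_less_top)
    finally show ?thesis
      using that(1) by (simp add: L2_iff_nn_integral)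
  qed
  have u_L2: "u k \<in> L2 M" for k
    by (rule bounded_L2[OF u_meas, where B="1 / sqrt D"]) (use D in \<open>simp add: u_def norm_mult norm_divide\<close>)
  have f_L2: "f \<in> L2 M"
  proof -
    have "(\<integral>\<^sup>+x. ennreal ((cmod (f x))\<^sup>2) \<partial>M) \<le> (\<integral>\<^sup>+x. ennreal ((cmod (f x))\<^sup>2) \<partial>lborel)"
      by (subst nn_integral_M) (auto intro!: nn_integral_mono simp: indicator_def)
    then show ?thesis
      using f by (auto simp: L2_iff_nn_integral)
  qed
  have "(\<lambda>k. (cmod (L2_inner M (u k) f))\<^sup>2) sums (L2_norm M f)\<^sup>2"
  proof (rule complete_orthonormal_Parseval[OF u_L2 _ _ f_L2])
    fix i j
    have "L2_inner M (u i) (u j) = (LINT x|lborel. indicator ?J x *\<^sub>R (cnj (u i x) * u j x))"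
      unfolding L2_inner_def by (rule integral_M) measurable
    also have "\<dots> = (LINT x|lborel. complex_of_real (1 / D) *
        (indicator ?J x *\<^sub>R cis (2 * pi * of_int (int_decode j - int_decode i) * x / D)))"
    proof (rule Bochner_Integration.integral_cong[OF refl])
      fix x
      have "2 * pi * of_int (int_decode j - int_decode i) * x / D
          = - (2 * pi * of_int (int_decode i) * x / D) + 2 * pi * of_int (int_decode j) * x / D"
        by (simp add: left_diff_distrib right_diff_distrib diff_divide_distrib)
      moreover have "complex_of_real (1 / sqrt D) * complex_of_real (1 / sqrt D) = complex_of_real (1 / D)"
        using D by (simp flip: of_real_mult)
      ultimately show "indicator ?J x *\<^sub>R (cnj (u i x) * u j x) = complex_of_real (1 / D) *
          (indicator ?J x *\<^sub>R cis (2 * pi * of_int (int_decode j - int_decode i) * x / D))"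
        unfolding u_def
        by (simp only: complex_cnj_mult complex_cnj_complex_of_real cis_cnj cis_mult[symmetric] mult_scaleR_right mult_ac)
          (simp only: mult.assoc[symmetric])
    qed
    also have "\<dots> = complex_of_real (1 / D) *
        (LINT x|lborel. indicator ?J x *\<^sub>R cis (2 * pi * of_int (int_decode j - int_decode i) * x / D))"
      by (rule integral_mult_right_zero)
    also have "\<dots> = (if i = j then 1 else 0)"
      unfolding integral_cis_period[OF D] using D by (auto simp: int_decode_eq simp flip: of_real_mult)
    finally show "L2_inner M (u i) (u j) = (if i = j then 1 else 0)" .
  next
    fix h assume h: "h \<in> L2 M" and zero: "\<And>k. L2_inner M (u k) h = 0"
    have h_meas [measurable]: "h \<in> borel_measurable borel"
      using L2_measurable[OF h] unfolding measurable_cong_sets[OF sets_M refl] .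
    let ?h = "\<lambda>x. indicator ?J x *\<^sub>R h x"
    have "integrable M (\<lambda>x. h x * 1)"
      by (rule L2_mult_integrable[OF h bounded_L2[where B=1]]) auto
    then have int: "integrable lborel ?h"
      unfolding M_def by (subst (asm) integrable_density) auto
    have "(LINT x|lborel. ?h x * cis (2 * pi * of_int m * x / D)) = 0" for m
    proof -
      \<comment> \<open>The inner product conjugates \<open>u\<close>, which reverses the frequency;
        hence the index of \<open>- m\<close>.\<close>
      have "0 = L2_inner M (u (int_encode (- m))) h"
        by (simp add: zero)
      also have "\<dots> = (LINT x|lborel. indicator ?J x *\<^sub>R (cnj (u (int_encode (- m)) x) * h x))"
        unfolding L2_inner_def by (rule integral_M) measurable
      also have "\<dots> = (LINT x|lborel. complex_of_real (1 / sqrt D) * (?h x * cis (2 * pi * of_int m * x / D)))"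
        by (rule Bochner_Integration.integral_cong) (auto simp: u_def cis_cnj)
      also have "\<dots> = complex_of_real (1 / sqrt D) * (LINT x|lborel. ?h x * cis (2 * pi * of_int m * x / D))"
        by (rule integral_mult_right_zero)
      finally show ?thesis
        using D by simp
    qed
    then have "?h \<in> trig_annihilator D"
      using int by (simp add: trig_annihilator_def)
    then have "AE x in lborel. ?h x = 0"
      by (rule trig_annihilator_eq_0[OF D, where a=a]) auto
    then show "AE x in M. h x = 0"
      unfolding M_def by (subst AE_density) (auto elim!: eventually_mono simp: indicator_def)
  qed
  moreover have "(cmod (L2_inner M (u k) f))\<^sup>2 = 1 / D * (cmod (c (int_decode k)))\<^sup>2" for k
  proof -
    have "L2_inner M (u k) f = (LINT x|lborel. indicator ?J x *\<^sub>R (cnj (u k x) * f x))"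
      unfolding L2_inner_def by (rule integral_M) measurable
    also have "\<dots> = (LINT x|lborel. complex_of_real (1 / sqrt D) * (f x * cis (- (2 * pi * of_int (int_decode k) * x / D))))"
      by (rule Bochner_Integration.integral_cong) (use supp in \<open>auto simp: u_def cis_cnj indicator_def\<close>)
    also have "\<dots> = complex_of_real (1 / sqrt D) * c (int_decode k)"
      unfolding c_def by (rule integral_mult_right_zero)
    finally show ?thesis
      using D by (simp add: norm_mult norm_divide power_divide)
  qed
  ultimately have "(\<lambda>k. D * (1 / D * (cmod (c (int_decode k)))\<^sup>2)) sums (D * (L2_norm M f)\<^sup>2)"
    by (intro sums_mult) simp
  then have "(\<lambda>k. (cmod (c (int_decode k)))\<^sup>2) sums (D * (L2_norm M f)\<^sup>2)"
    using D by simp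
  then have "(\<integral>\<^sup>+k. ennreal ((cmod (c (int_decode k)))\<^sup>2) \<partial>count_space UNIV) = ennreal (D * (L2_norm M f)\<^sup>2)"
    by (rule nn_integral_count_space_of_sums) simp
  moreover have "(\<integral>\<^sup>+k. ennreal ((cmod (c (int_decode k)))\<^sup>2) \<partial>count_space UNIV)
      = (\<integral>\<^sup>+m. ennreal ((cmod (c m))\<^sup>2) \<partial>count_space UNIV)"
    by (rule nn_integral_bij_count_space[OF bij_int_decode])
  moreover have "ennreal ((L2_norm M f)\<^sup>2) = (\<integral>\<^sup>+x. ennreal ((cmod (f x))\<^sup>2) \<partial>lborel)"
    unfolding nn_integral_L2[OF f_L2, symmetric] using supp
    by (subst nn_integral_M) (auto intro!: nn_integral_cong simp: indicator_def)
  ultimately show ?thesis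
    using D by (simp add: c_def ennreal_mult)
qed

section \<open>Plancherel's theorem\<close>

lemma fourier_integral_measurable [measurable]:
  assumes [measurable]: "f \<in> borel_measurable borel"
  shows "fourier_integral f \<in> borel_measurable borel"
proof -
  have "(\<lambda>w. LINT x|lborel. f x * cis (- (w * x))) \<in> borel_measurable borel"
    by (rule lborel.borel_measurable_lebesgue_integral) measurable
  then show ?thesis
    unfolding fourier_integral_def by measurable
qed

text \<open>For each \<open>s\<close> exactly one integer \<open>m\<close> puts \<open>s - m\<close>
  into the half-open unit interval, namely the floor of \<open>s\<close>. Inserting this partition
  of unity and exchanging sum and integral gives the formula.\<close>

lemma nn_integral_unit_shifts:
  fixes H :: "real \<Rightarrow> ennreal"
  assumes [measurable]: "H \<in> borel_measurable borel"
  shows "(\<integral>\<^sup>+s. H s \<partial>lborel)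
    = (\<integral>\<^sup>+t. indicator {0..<1} t * (\<integral>\<^sup>+m. H (of_int m + t) \<partial>count_space (UNIV :: int set)) \<partial>lborel)"
proof -
  have "(\<integral>\<^sup>+m. indicator {0..<1} (s - of_int m) * H s \<partial>count_space (UNIV :: int set)) = H s" for s
  proof -
    have "indicator {0..<1} (s - of_int m) * H s = H s * indicator {\<lfloor>s\<rfloor>} m" for m
      by (auto simp: indicator_def) linarith+
    then show ?thesis
      by (simp add: nn_integral_cmult_indicator)
  qed
  then have "(\<integral>\<^sup>+s. H s \<partial>lborel)
      = (\<integral>\<^sup>+s. (\<integral>\<^sup>+m. indicator {0..<1} (s - of_int m) * H s \<partial>count_space (UNIV :: int set)) \<partial>lborel)"
    by simp
  also have "\<dots> = (\<integral>\<^sup>+m. (\<integral>\<^sup>+s. indicator {0..<1} (s - of_int m) * H s \<partial>lborel) \<partial>count_space (UNIV :: int set))"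
    by (rule nn_integral_count_space_nn_integral) auto
  also have "\<dots> = (\<integral>\<^sup>+m. (\<integral>\<^sup>+t. indicator {0..<1} t * H (of_int m + t) \<partial>lborel) \<partial>count_space (UNIV :: int set))"
  proof (rule nn_integral_cong)
    fix m :: int
    show "(\<integral>\<^sup>+s. indicator {0..<1} (s - of_int m) * H s \<partial>lborel) = (\<integral>\<^sup>+t. indicator {0..<1} t * H (of_int m + t) \<partial>lborel)"
      by (subst nn_integral_real_affine[where c=1 and t="of_int m"]) auto
  qed
  also have "\<dots> = (\<integral>\<^sup>+t. (\<integral>\<^sup>+m. indicator {0..<1} t * H (of_int m + t) \<partial>count_space (UNIV :: int set)) \<partial>lborel)"
    by (rule nn_integral_count_space_nn_integral[symmetric]) auto
  finally show ?thesis
    by (simp add: nn_integral_cmult)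
qed

text \<open>At frequency \<open>2 * pi * (m + t) / D\<close> the transform is, up to
  \<open>1 / sqrt (2 * pi)\<close>, a Fourier coefficient of \<open>f\<close> times an exponential
  of modulus one. The sum over \<open>m\<close> is thus independent of \<open>t\<close>, and its
  constant \<open>D / (2 * pi)\<close> is cancelled by the change of frequency variable.\<close>

lemma Plancherel_compact_support:
  assumes D: "D > 0" and f: "f \<in> L2 lborel" and supp: "\<And>x. x \<notin> {a..a + D} \<Longrightarrow> f x = 0"
  shows "(\<integral>\<^sup>+w. ennreal ((cmod (fourier_integral f w))\<^sup>2) \<partial>lborel) = (\<integral>\<^sup>+x. ennreal ((cmod (f x))\<^sup>2) \<partial>lborel)"
proof -
  have [measurable]: "f \<in> borel_measurable borel"
    using f by (simp add: L2_def)
  let ?N = "\<integral>\<^sup>+x. ennreal ((cmod (f x))\<^sup>2) \<partial>lborel"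
  define H where "H s = ennreal ((cmod (fourier_integral f (2 * pi / D * s)))\<^sup>2)" for s
  have [measurable]: "H \<in> borel_measurable borel"
    unfolding H_def by measurable
  have H_sum: "(\<integral>\<^sup>+m. H (of_int m + t) \<partial>count_space (UNIV :: int set)) = ennreal (D / (2 * pi)) * ?N" for t
  proof -
    let ?f = "\<lambda>x. f x * cis (- (2 * pi * t * x / D))"
    have ft: "H (of_int m + t) = ennreal (1 / (2 * pi)) *
        ennreal ((cmod (LINT x|lborel. ?f x * cis (- (2 * pi * of_int m * x / D))))\<^sup>2)" for m
    proof -
      have "f x * cis (- (2 * pi / D * (of_int m + t) * x)) = ?f x * cis (- (2 * pi * of_int m * x / D))" for x
      proof -
        have "- (2 * pi / D * (of_int m + t) * x) = - (2 * pi * t * x / D) + - (2 * pi * of_int m * x / D)"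
          using D by (simp add: field_simps)
        then show ?thesis
          by (simp only: cis_mult[symmetric] mult.assoc)
      qed
      then have I: "(LINT x|lborel. f x * cis (- (2 * pi / D * (of_int m + t) * x)))
          = (LINT x|lborel. ?f x * cis (- (2 * pi * of_int m * x / D)))"
        by (simp only:)
      show ?thesis
        unfolding H_def fourier_integral_def I
        by (simp add: norm_mult norm_divide power_mult_distrib power_divide ennreal_mult'' flip: ennreal_mult)
    qed
    have "?f \<in> L2 lborel"
      using f by (rule L2_bounded_by) (auto simp: norm_mult)
    then have "(\<integral>\<^sup>+m. ennreal ((cmod (LINT x|lborel. ?f x * cis (- (2 * pi * of_int m * x / D))))\<^sup>2) \<partial>count_space (UNIV :: int set))
        = ennreal D * (\<integral>\<^sup>+x. ennreal ((cmod (?f x))\<^sup>2) \<partial>lborel)"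
      by (rule Fourier_series_Parseval[OF D, where a=a]) (use supp in auto)
    then have "(\<integral>\<^sup>+m. H (of_int m + t) \<partial>count_space (UNIV :: int set)) = ennreal (1 / (2 * pi)) * (ennreal D * ?N)"
      unfolding ft by (simp add: nn_integral_cmult norm_mult)
    then show ?thesis
      using D by (simp add: mult.assoc[symmetric] flip: ennreal_mult)
  qed
  have "(\<integral>\<^sup>+w. ennreal ((cmod (fourier_integral f w))\<^sup>2) \<partial>lborel) = ennreal (2 * pi / D) * (\<integral>\<^sup>+s. H s \<partial>lborel)"
    unfolding H_def using D by (subst nn_integral_real_affine[where c="2 * pi / D" and t=0]) auto
  also have "(\<integral>\<^sup>+s. H s \<partial>lborel) = (\<integral>\<^sup>+t. (ennreal (D / (2 * pi)) * ?N) * indicator {0..<1::real} t \<partial>lborel)"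
    by (subst nn_integral_unit_shifts) (simp_all add: H_sum mult.commute)
  also have "\<dots> = ennreal (D / (2 * pi)) * ?N"
    by (subst nn_integral_cmult_indicator) auto
  also have "ennreal (2 * pi / D) * (ennreal (D / (2 * pi)) * ?N) = ?N"
    using D by (simp add: mult.assoc[symmetric] flip: ennreal_mult)
  finally show ?thesis .
qed

text \<open>The indicator of a bounded interval is itself in L2, so \<open>f\<close> is a product of
  two L2 functions. This makes the Bochner integral defining the transform of a truncation a genuine
  one.\<close>

lemma L2_compact_support_integrable:
  fixes a b :: real
  assumes f: "f \<in> L2 lborel" and supp: "\<And>x. x \<notin> {a..b} \<Longrightarrow> f x = 0"
  shows "integrable lborel f"
proof -
  have "(indicator {a..b} :: real \<Rightarrow> complex) \<in> L2 lborel"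
  proof -
    have "(\<integral>\<^sup>+x. ennreal ((cmod (indicator {a..b} x))\<^sup>2) \<partial>lborel) = (\<integral>\<^sup>+x. indicator {a..b} x \<partial>lborel)"
      by (rule nn_integral_cong) (simp add: indicator_def)
    then show ?thesis
      by (auto simp: L2_iff_nn_integral emeasure_lborel_Icc_eq)
  qed
  from L2_mult_integrable[OF f this] show ?thesis
    by (rule back_subst[where P="integrable lborel"]) (use supp in \<open>auto simp: fun_eq_iff indicator_def\<close>)
qed

lemma fourier_integral_linear:
  assumes "integrable lborel f" "integrable lborel g"
  shows "fourier_integral (\<lambda>x. f x + c * g x) w = fourier_integral f w + c * fourier_integral g w"
proof -
  have int: "integrable lborel (\<lambda>x. h x * cis (- (w * x)))" if "integrable lborel h" for h
    using that by (rule integrable_mult_bounded[where B=1]) auto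
  have "(LINT x|lborel. (f x + c * g x) * cis (- (w * x)))
      = (LINT x|lborel. f x * cis (- (w * x)) + c * (g x * cis (- (w * x))))"
    by (simp add: distrib_right mult.assoc)
  also have "\<dots> = (LINT x|lborel. f x * cis (- (w * x))) + c * (LINT x|lborel. g x * cis (- (w * x)))"
    using int[OF assms(1)] int[OF assms(2)] by simp
  finally show ?thesis
    by (simp add: fourier_integral_def distrib_left mult_ac)
qed

section \<open>Extension of the Fourier transform from truncations to L2\<close>

definition truncate :: "nat \<Rightarrow> (real \<Rightarrow> complex) \<Rightarrow> real \<Rightarrow> complex" where
  "truncate N f = (\<lambda>x. indicator {- real N..real N} x * f x)"

lemma truncate_outside: "x \<notin> {- real N..real N} \<Longrightarrow> truncate N f x = 0"
  by (simp add: truncate_def)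

lemma truncate_L2:
  assumes "f \<in> L2 lborel"
  shows "truncate N f \<in> L2 lborel"
proof (rule L2_bounded_by[OF assms])
  have [measurable]: "f \<in> borel_measurable borel"
    using assms by (simp add: L2_def)
  show "truncate N f \<in> borel_measurable lborel"
    unfolding truncate_def by measurable
  show "cmod (truncate N f x) \<le> cmod (f x)" for x
    by (simp add: truncate_def indicator_def)
qed

lemma truncate_integrable:
  assumes "f \<in> L2 lborel"
  shows "integrable lborel (truncate N f)"
  by (rule L2_compact_support_integrable[OF truncate_L2[OF assms] truncate_outside])

lemma truncate_tendsto:
  assumes f: "f \<in> L2 lborel"
  shows "(\<lambda>N. L2_norm lborel (\<lambda>x. truncate N f x - f x)) \<longlonglongrightarrow> 0"
proof -
  have [measurable]: "f \<in> borel_measurable borel" "truncate N f \<in> borel_measurable borel" for N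
    using f truncate_L2[OF f] by (auto simp: L2_def)
  have "(\<lambda>N. LINT x|lborel. (cmod (truncate N f x - f x))\<^sup>2) \<longlonglongrightarrow> (LINT x|(lborel :: real measure). (0::real))"
  proof (rule integral_dominated_convergence[where w="\<lambda>x. (cmod (f x))\<^sup>2"
        and s="\<lambda>N x. (cmod (truncate N f x - f x))\<^sup>2" and f="\<lambda>_. 0"])
    show "integrable lborel (\<lambda>x. (cmod (f x))\<^sup>2)"
      using f by (simp add: L2_def)
    show "AE x in lborel. (\<lambda>N. (cmod (truncate N f x - f x))\<^sup>2) \<longlonglongrightarrow> 0"
    proof (intro always_eventually allI)
      fix x
      obtain n where n: "\<bar>x\<bar> \<le> real n"
        using real_arch_simple by blast
      have "(cmod (truncate N f x - f x))\<^sup>2 = 0" if "N \<ge> n" for N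
      proof -
        have "x \<in> {- real N..real N}"
          using n that by (auto simp: abs_le_iff intro: order_trans)
        then show ?thesis
          by (simp add: truncate_def)
      qed
      then show "(\<lambda>N. (cmod (truncate N f x - f x))\<^sup>2) \<longlonglongrightarrow> 0"
        by (intro tendsto_eventually) (auto simp: eventually_sequentially)
    qed
    show "AE x in lborel. norm ((cmod (truncate N f x - f x))\<^sup>2) \<le> (cmod (f x))\<^sup>2" for N
      by (intro always_eventually allI) (auto simp: truncate_def indicator_def)
  qed auto
  from tendsto_real_sqrt[OF this] show ?thesis
    by (simp add: L2_norm_def)
qed

lemma fourier_integral_compact_L2:
  assumes "f \<in> L2 lborel" "\<And>x. x \<notin> {- real N..real N} \<Longrightarrow> f x = 0"
  shows "fourier_integral f \<in> L2 lborel" "L2_norm lborel (fourier_integral f) = L2_norm lborel f"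
proof -
  have [measurable]: "f \<in> borel_measurable borel"
    using assms by (simp add: L2_def)
  have eq: "(\<integral>\<^sup>+w. ennreal ((cmod (fourier_integral f w))\<^sup>2) \<partial>lborel) = (\<integral>\<^sup>+x. ennreal ((cmod (f x))\<^sup>2) \<partial>lborel)"
    \<comment> \<open>The interval is enlarged by 1 on both sides so that its length is positive
      even for \<open>N = 0\<close>.\<close>
    by (rule Plancherel_compact_support[where a="- real N - 1" and D="2 * real N + 2", OF _ assms(1)])
      (use assms(2) in auto)
  then show L2: "fourier_integral f \<in> L2 lborel"
    using assms(1) by (simp add: L2_iff_nn_integral)
  have "(L2_norm lborel (fourier_integral f))\<^sup>2 = (L2_norm lborel f)\<^sup>2"
    using eq unfolding nn_integral_L2[OF L2] nn_integral_L2[OF assms(1)] by simp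
  then show "L2_norm lborel (fourier_integral f) = L2_norm lborel f"
    by (simp add: power2_eq_iff_nonneg)
qed

text \<open>Polarization: isometry on all combinations \<open>f + c g\<close> fixes the real part of
  \<open>c\<close> times the inner product. The values \<open>c = 1\<close> and
  \<open>c = - \<i>\<close> read off its real and imaginary parts.\<close>

lemma fourier_integral_compact_inner:
  assumes f: "f \<in> L2 lborel" "\<And>x. x \<notin> {- real N..real N} \<Longrightarrow> f x = 0"
    and g: "g \<in> L2 lborel" "\<And>x. x \<notin> {- real N..real N} \<Longrightarrow> g x = 0"
  shows "L2_inner lborel (fourier_integral f) (fourier_integral g) = L2_inner lborel f g"
proof -
  let ?F = "fourier_integral f" and ?G = "fourier_integral g"
  have F: "?F \<in> L2 lborel" "L2_norm lborel ?F = L2_norm lborel f"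
    and G: "?G \<in> L2 lborel" "L2_norm lborel ?G = L2_norm lborel g"
    using fourier_integral_compact_L2[of f N] fourier_integral_compact_L2[of g N] f g by auto
  have "Re (c * L2_inner lborel ?F ?G) = Re (c * L2_inner lborel f g)" for c
  proof -
    have fg: "(\<lambda>x. f x + c * g x) \<in> L2 lborel"
      using f g by (intro L2_add L2_cmult)
    have "fourier_integral (\<lambda>x. f x + c * g x) = (\<lambda>w. ?F w + c * ?G w)"
      using L2_compact_support_integrable[OF f] L2_compact_support_integrable[OF g]
      by (intro ext fourier_integral_linear)
    then have "(L2_norm lborel (\<lambda>w. ?F w + c * ?G w))\<^sup>2 = (L2_norm lborel (\<lambda>x. f x + c * g x))\<^sup>2"
      using fourier_integral_compact_L2(2)[OF fg, of N] f(2) g(2) by simp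
    then show ?thesis
      using L2_norm_add_power2[OF F(1) G(1), of c, unfolded F(2) G(2)] L2_norm_add_power2[OF f(1) g(1), of c]
      by linarith
  qed
  from this[of 1] this[of "- \<i>"] show ?thesis
    by (simp add: complex_eq_iff)
qed

text \<open>A difference of two truncations lives on the larger of the two intervals, so the
  isometry applies to it and carries the Cauchy property over to the transforms. Their L2 limit is
  the witness that discharges the choice in \<open>fourier\<close>.\<close>

lemma fourier_spec:
  assumes f: "f \<in> L2 lborel"
  shows "fourier f \<in> L2 lborel"
    and "(\<lambda>N. L2_norm lborel (\<lambda>w. fourier_integral (truncate N f) w - fourier f w)) \<longlonglongrightarrow> 0"
proof -
  let ?T = "\<lambda>N. fourier_integral (truncate N f)"
  have T: "?T N \<in> L2 lborel" for N
    by (rule fourier_integral_compact_L2(1)[OF truncate_L2[OF f] truncate_outside])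
  have T_diff: "L2_norm lborel (\<lambda>w. ?T m w - ?T n w) = L2_norm lborel (\<lambda>x. truncate m f x - truncate n f x)" for m n
  proof -
    have "?T m w - ?T n w = fourier_integral (\<lambda>x. truncate m f x - truncate n f x) w" for w
      using fourier_integral_linear[OF truncate_integrable[OF f, of m] truncate_integrable[OF f, of n], of "-1"] by simp
    moreover have "truncate m f x - truncate n f x = 0" if "x \<notin> {- real (max m n)..real (max m n)}" for x
      using that by (auto simp: truncate_def indicator_def)
    ultimately show ?thesis
      using fourier_integral_compact_L2(2)[OF L2_diff[OF truncate_L2[OF f, of m] truncate_L2[OF f, of n]], of "max m n"]
      by simp
  qed
  obtain g where g: "g \<in> L2 lborel" "(\<lambda>N. L2_norm lborel (\<lambda>w. ?T N w - g w)) \<longlonglongrightarrow> 0"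
  proof (rule L2_complete[OF T])
    fix e :: real assume "e > 0"
    then obtain N where N: "\<And>n. n \<ge> N \<Longrightarrow> L2_norm lborel (\<lambda>x. truncate n f x - f x) < e / 2"
      using truncate_tendsto[OF f] unfolding LIMSEQ_def
      by (metis L2_norm_nonneg abs_of_nonneg diff_zero dist_real_def half_gt_zero)
    have "L2_norm lborel (\<lambda>w. ?T m w - ?T n w) < e" if "m \<ge> N" "n \<ge> N" for m n
      using L2_norm_triangle_diff[OF truncate_L2[OF f, of m] f truncate_L2[OF f, of n]] N[OF that(1)] N[OF that(2)]
        L2_norm_minus_commute[of lborel f "truncate n f"]
      unfolding T_diff by simp
    then show "\<exists>N. \<forall>m\<ge>N. \<forall>n\<ge>N. L2_norm lborel (\<lambda>w. ?T m w - ?T n w) < e"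
      by blast
  qed
  \<comment> \<open>For members of L2 the nonnegative integral in the definition is the squared
    norm, so the two notions of convergence coincide.\<close>
  have nn: "(\<integral>\<^sup>+w. ennreal ((cmod (h w - fourier_integral (\<lambda>x. indicator {- real N..real N} x * f x) w))\<^sup>2) \<partial>lborel)
      = ennreal ((L2_norm lborel (\<lambda>w. ?T N w - h w))\<^sup>2)" if "h \<in> L2 lborel" for h N
    unfolding truncate_def[symmetric] nn_integral_L2[OF L2_diff[OF that T]]
    by (simp add: L2_norm_minus_commute[of lborel h])
  let ?P = "\<lambda>g. g \<in> L2 lborel \<and> (\<lambda>N::nat. \<integral>\<^sup>+w. ennreal ((cmod (g w -
         fourier_integral (\<lambda>x. indicator {- real N..real N} x * f x) w))\<^sup>2) \<partial>lborel) \<longlonglongrightarrow> 0"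
  have "(\<lambda>N. ennreal ((L2_norm lborel (\<lambda>w. ?T N w - g w))\<^sup>2)) \<longlonglongrightarrow> ennreal (0\<^sup>2)"
    by (intro tendsto_ennrealI tendsto_power g)
  then have "?P g"
    using g by (simp add: nn)
  then have P: "?P (fourier f)"
    unfolding fourier_def by (rule someI[where P="?P"])
  then show L2: "fourier f \<in> L2 lborel"
    by (rule conjunct1)
  have "(\<lambda>N. ennreal ((L2_norm lborel (\<lambda>w. ?T N w - fourier f w))\<^sup>2)) \<longlonglongrightarrow> ennreal 0"
    using conjunct2[OF P] unfolding nn[OF L2] ennreal_0 .
  then have "(\<lambda>N. (L2_norm lborel (\<lambda>w. ?T N w - fourier f w))\<^sup>2) \<longlonglongrightarrow> 0"
    by (subst (asm) tendsto_ennreal_iff) auto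
  from tendsto_real_sqrt[OF this] show "(\<lambda>N. L2_norm lborel (\<lambda>w. ?T N w - fourier f w)) \<longlonglongrightarrow> 0"
    by simp
qed

lemma fourier_integral_truncate_L2:
  assumes "f \<in> L2 lborel"
  shows "fourier_integral (truncate N f) \<in> L2 lborel"
  by (rule fourier_integral_compact_L2(1)[OF truncate_L2[OF assms] truncate_outside])

theorem Plancherel_inner:
  assumes f: "f \<in> L2 lborel" and g: "g \<in> L2 lborel"
  shows "L2_inner lborel (fourier f) (fourier g) = L2_inner lborel f g"
proof -
  have "L2_inner lborel (fourier_integral (truncate N f)) (fourier_integral (truncate N g))
      = L2_inner lborel (truncate N f) (truncate N g)" for N
    by (rule fourier_integral_compact_inner[of _ N]) (simp_all add: truncate_L2 f g truncate_outside)
  moreover have "(\<lambda>N. L2_inner lborel (fourier_integral (truncate N f)) (fourier_integral (truncate N g)))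
      \<longlonglongrightarrow> L2_inner lborel (fourier f) (fourier g)"
    by (rule L2_inner_tendsto) (simp_all add: f g fourier_integral_truncate_L2 fourier_spec)
  moreover have "(\<lambda>N. L2_inner lborel (truncate N f) (truncate N g)) \<longlonglongrightarrow> L2_inner lborel f g"
    by (rule L2_inner_tendsto) (simp_all add: f g truncate_L2 truncate_tendsto)
  ultimately show ?thesis
    by (simp add: LIMSEQ_unique)
qed

corollary Plancherel_norm:
  assumes "f \<in> L2 lborel"
  shows "L2_norm lborel (fourier f) = L2_norm lborel f"
  using Plancherel_inner[OF assms assms]
  unfolding L2_inner_self of_real_eq_iff by (simp add: power2_eq_iff_nonneg)

text \<open>The kernel \<open>cis (- (w * x))\<close> is symmetric in its two variables and has
  modulus one, so Fubini applies to the product of two integrable functions.\<close>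

lemma fourier_integral_multiplication:
  assumes f: "integrable lborel f" and g: "integrable lborel g"
  shows "(LINT w|lborel. fourier_integral f w * g w) = (LINT x|lborel. f x * fourier_integral g x)"
proof -
  let ?h = "\<lambda>x w. f x * g w * cis (- (w * x))"
  let ?c = "complex_of_real (1 / sqrt (2 * pi))"
  have [measurable]: "f \<in> borel_measurable borel" "g \<in> borel_measurable borel"
    using f g by auto
  have "integrable (lborel \<Otimes>\<^sub>M lborel) (\<lambda>(x, w). ?h x w)"
  proof (rule lborel_pair.Fubini_integrable)
    have "integrable lborel (\<lambda>x. cmod (f x) * (LINT w|lborel. cmod (g w)))"
      using f by auto
    then show "integrable lborel (\<lambda>x. LINT w|lborel. norm (case (x, w) of (x, w) \<Rightarrow> ?h x w))"
      by (simp add: norm_mult)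
    have "integrable lborel (\<lambda>w. ?h x w)" for x
    proof -
      have "integrable lborel (\<lambda>w. (f x * g w) * cis (- (w * x)))"
        by (rule integrable_mult_bounded[where B=1]) (use g in auto)
      then show ?thesis
        by simp
    qed
    then show "AE x in lborel. integrable lborel (\<lambda>w. case (x, w) of (x, w) \<Rightarrow> ?h x w)"
      by simp
  qed measurable
  then have "(LINT w|lborel. LINT x|lborel. ?h x w) = (LINT x|lborel. LINT w|lborel. ?h x w)"
    by (rule lborel_pair.Fubini_integral)
  moreover have "?c * (LINT w|lborel. LINT x|lborel. ?h x w) = (LINT w|lborel. fourier_integral f w * g w)"
  proof -
    have "(LINT x|lborel. ?h x w) = (LINT x|lborel. g w * (f x * cis (- (w * x))))" for w
      by (simp add: mult_ac)
    then show ?thesis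
      unfolding fourier_integral_def by (simp add: mult_ac flip: integral_mult_right_zero)
  qed
  moreover have "?c * (LINT x|lborel. LINT w|lborel. ?h x w) = (LINT x|lborel. f x * fourier_integral g x)"
  proof -
    have "(LINT w|lborel. ?h x w) = (LINT w|lborel. f x * (g w * cis (- (x * w))))" for x
      by (simp add: mult_ac)
    then show ?thesis
      unfolding fourier_integral_def by (simp add: mult_ac flip: integral_mult_right_zero)
  qed
  ultimately show ?thesis
    by simp
qed

text \<open>The pairing is bilinear. Conjugating the first factor presents it as an inner product,
  whose continuity then extends the formula from truncations to L2.\<close>

lemma fourier_multiplication:
  assumes f: "f \<in> L2 lborel" and g: "g \<in> L2 lborel"
  shows "(LINT w|lborel. fourier f w * g w) = (LINT x|lborel. f x * fourier g x)"
proof -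
  let ?F = "\<lambda>N. fourier_integral (truncate N f)" and ?G = "\<lambda>N. fourier_integral (truncate N g)"
  have cnj_norm: "L2_norm M (\<lambda>x. cnj (u x) - cnj (v x)) = L2_norm M (\<lambda>x. u x - v x)" for M :: "real measure" and u v
    by (simp add: L2_norm_def flip: complex_cnj_diff)
  have "L2_inner lborel (\<lambda>w. cnj (?F N w)) (truncate N g) = L2_inner lborel (\<lambda>x. cnj (truncate N f x)) (?G N)" for N
    using fourier_integral_multiplication[OF truncate_integrable[OF f] truncate_integrable[OF g]]
    by (simp add: L2_inner_def)
  moreover have "(\<lambda>N. L2_inner lborel (\<lambda>w. cnj (?F N w)) (truncate N g)) \<longlonglongrightarrow> L2_inner lborel (\<lambda>w. cnj (fourier f w)) g"
    by (rule L2_inner_tendsto)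
      (simp_all add: f g L2_cnj truncate_L2 fourier_integral_truncate_L2 fourier_spec truncate_tendsto cnj_norm)
  moreover have "(\<lambda>N. L2_inner lborel (\<lambda>x. cnj (truncate N f x)) (?G N)) \<longlonglongrightarrow> L2_inner lborel (\<lambda>x. cnj (f x)) (fourier g)"
    by (rule L2_inner_tendsto)
      (simp_all add: f g L2_cnj truncate_L2 fourier_integral_truncate_L2 fourier_spec truncate_tendsto cnj_norm)
  ultimately have "L2_inner lborel (\<lambda>w. cnj (fourier f w)) g = L2_inner lborel (\<lambda>x. cnj (f x)) (fourier g)"
    by (simp add: LIMSEQ_unique)
  then show ?thesis
    by (simp add: L2_inner_def)
qed

theorem fourier_surj:
  assumes h: "h \<in> L2 lborel"
  obtains k where "k \<in> L2 lborel" "AE w in lborel. fourier k w = h w"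
proof
  let ?H = "fourier (\<lambda>x. cnj (h x))"
  \<comment> \<open>Conjugation before and after the transform reverses the sign in its kernel, so
    \<open>?k\<close> is the inverse transform of \<open>h\<close>.\<close>
  let ?k = "\<lambda>x. cnj (?H x)"
  have h': "(\<lambda>x. cnj (h x)) \<in> L2 lborel"
    by (rule L2_cnj[OF h])
  show k: "?k \<in> L2 lborel"
    by (intro L2_cnj fourier_spec h')
  have norm_k: "L2_norm lborel ?k = L2_norm lborel h"
    using Plancherel_norm[OF h'] by simp
  have "L2_inner lborel (fourier ?k) h = cnj (LINT w|lborel. fourier ?k w * cnj (h w))"
    by (simp add: L2_inner_def flip: Bochner_Integration.integral_cnj)
  also have "\<dots> = cnj (LINT x|lborel. ?k x * ?H x)"
    by (simp only: fourier_multiplication[OF k h'])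
  also have "(LINT x|lborel. ?k x * ?H x) = L2_inner lborel ?H ?H"
    by (simp add: L2_inner_def)
  also have "cnj \<dots> = complex_of_real ((L2_norm lborel h)\<^sup>2)"
    unfolding L2_inner_self Plancherel_norm[OF h'] by simp
  \<comment> \<open>In the expanded square both squared norms and the inner product equal the
    squared norm of \<open>h\<close>, so the sum is 1 + 1 - 2 times it.\<close>
  finally have "(L2_norm lborel (\<lambda>w. fourier ?k w - h w))\<^sup>2 = 0"
    unfolding L2_norm_diff_power2[OF fourier_spec(1)[OF k] h] Plancherel_norm[OF k] norm_k by simp
  then show "AE w in lborel. fourier ?k w = h w"
    using L2_norm_eq_0_AE[OF L2_diff[OF fourier_spec(1)[OF k] h]] by simp
qed

section \<open>The operators \<open>T1\<close> and \<open>I_op\<close>\<close>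

text \<open>A Borel measure giving every box its length is Lebesgue measure;
  \<open>ln x / \<epsilon>\<close> is the primitive that yields these lengths. As an equality of
  measures the substitution serves nonnegative and Bochner integrals alike. The density vanishes for
  \<open>u \<le> 0\<close>, where the value of \<open>ln\<close> is immaterial.\<close>

lemma lborel_exp_substitution:
  fixes \<epsilon> :: real
  assumes \<epsilon>: "\<epsilon> > 0"
  shows "lborel = distr (density lborel (\<lambda>u. ennreal (indicator {0<..} u / (\<epsilon> * u)))) borel (\<lambda>u. - ln u / \<epsilon>)"
    (is "_ = distr ?M borel ?g")
proof (rule lborel_eqI)
  fix l u :: real assume "\<And>b. b \<in> Basis \<Longrightarrow> l \<bullet> b \<le> u \<bullet> b"
  then have lu: "l \<le> u"
    by simp
  let ?a = "exp (- \<epsilon> * u)" and ?b = "exp (- \<epsilon> * l)"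
  have ab: "?a \<le> ?b"
    using lu \<epsilon> by simp
  have "emeasure (distr ?M borel ?g) (box l u) = emeasure ?M (?g -` box l u)"
    by (subst emeasure_distr) auto
  also have "\<dots> = (\<integral>\<^sup>+x. ennreal (indicator {0<..} x / (\<epsilon> * x)) * indicator (?g -` box l u) x \<partial>lborel)"
    by (subst emeasure_density) (auto intro!: measurable_sets_borel[OF _ borel_open])
  also have "\<dots> = (\<integral>\<^sup>+x. ennreal (1 / (\<epsilon> * x)) * indicator {?a..?b} x \<partial>lborel)"
  proof (rule nn_integral_cong_AE)
    have eq: "ennreal (indicator {0<..} x / (\<epsilon> * x)) * indicator (?g -` box l u) x
        = ennreal (1 / (\<epsilon> * x)) * indicator {?a..?b} x" if "x \<noteq> ?a" "x \<noteq> ?b" for x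
    proof (cases "x > 0")
      case True
      have "l < - ln x / \<epsilon> \<longleftrightarrow> ln x < - \<epsilon> * l" "- ln x / \<epsilon> < u \<longleftrightarrow> - \<epsilon> * u < ln x"
        using \<epsilon> by (auto simp: field_simps)
      moreover have "ln x < - \<epsilon> * l \<longleftrightarrow> x < ?b" "- \<epsilon> * u < ln x \<longleftrightarrow> ?a < x"
        using True by (metis exp_less_cancel_iff exp_ln)+
      ultimately have "?g x \<in> box l u \<longleftrightarrow> x \<in> {?a..?b}"
        using that by auto
      then show ?thesis
        using True by (simp add: indicator_def)
    next
      case False
      moreover have "0 < ?a"
        by simp
      ultimately have "x \<notin> {?a..?b}"
        by (metis atLeastAtMost_iff less_le_trans)
      then show ?thesis
        using False by simp
    qed
    show "AE x in lborel. ennreal (indicator {0<..} x / (\<epsilon> * x)) * indicator (?g -` box l u) x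
        = ennreal (1 / (\<epsilon> * x)) * indicator {?a..?b} x"
      using AE_lborel_singleton[of ?a] AE_lborel_singleton[of ?b] by eventually_elim (rule eq)
  qed
  also have "\<dots> = ennreal (ln ?b / \<epsilon> - ln ?a / \<epsilon>)"
  proof (rule nn_integral_FTC_Icc)
    fix x assume "x \<in> {?a..?b}"
    moreover have "0 < ?a"
      by simp
    ultimately have x: "0 < x"
      by (metis atLeastAtMost_iff less_le_trans)
    show "((\<lambda>x. ln x / \<epsilon>) has_real_derivative 1 / (\<epsilon> * x)) (at x)"
      using x \<epsilon> by (auto intro!: derivative_eq_intros simp: field_simps)
    show "0 \<le> 1 / (\<epsilon> * x)"
      using x \<epsilon> by simp
  qed (use ab in auto)
  also have "ln ?b / \<epsilon> - ln ?a / \<epsilon> = u - l"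
    using \<epsilon> by (simp add: field_simps)
  finally show "emeasure (distr ?M borel ?g) (box l u) = ennreal (\<Prod>b\<in>Basis. (u - l) \<bullet> b)"
    by simp
qed simp

lemma nn_integral_exp_substitution:
  fixes \<epsilon> :: real
  assumes \<epsilon>: "\<epsilon> > 0" and F: "F \<in> borel_measurable borel"
  shows "(\<integral>\<^sup>+x. F x \<partial>lborel) = (\<integral>\<^sup>+u. ennreal (indicator {0<..} u / (\<epsilon> * u)) * F (- ln u / \<epsilon>) \<partial>lborel)"
proof -
  note [measurable] = F
  show ?thesis
    by (subst lborel_exp_substitution[OF \<epsilon>]) (simp add: nn_integral_distr nn_integral_density)
qed

lemma integral_exp_substitution:
  fixes \<epsilon> :: real and F :: "real \<Rightarrow> complex"
  assumes \<epsilon>: "\<epsilon> > 0" and F: "F \<in> borel_measurable borel"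
  shows "(LINT x|lborel. F x) = (LINT u|lborel. (indicator {0<..} u / (\<epsilon> * u)) *\<^sub>R F (- ln u / \<epsilon>))"
proof -
  note [measurable] = F
  have "AE u in lborel. 0 \<le> indicator {0<..} u / (\<epsilon> * u)"
    using \<epsilon> by (intro always_eventually allI) (simp add: indicator_def)
  then show ?thesis
    by (subst lborel_exp_substitution[OF \<epsilon>]) (simp add: integral_distr integral_density)
qed

text \<open>\<open>T1\<close> evaluates a transform, known only almost everywhere, at
  \<open>exp (- x)\<close>, so null sets must pull back to null sets. Equality is expressed as a
  vanishing integral of the modulus of the difference, which the substitution transforms.\<close>

lemma AE_exp_substitution:
  fixes f g :: "real \<Rightarrow> complex"
  assumes [measurable]: "f \<in> borel_measurable borel" "g \<in> borel_measurable borel"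
    and eq: "AE u in lborel. u > 0 \<longrightarrow> f u = g u"
  shows "AE x in lborel. f (exp (- x)) = g (exp (- x))"
proof -
  have "(\<integral>\<^sup>+x. ennreal (cmod (f (exp (- x)) - g (exp (- x)))) \<partial>lborel)
      = (\<integral>\<^sup>+u. ennreal (indicator {0<..} u / (1 * u)) * ennreal (cmod (f (exp (- (- ln u / 1))) - g (exp (- (- ln u / 1))))) \<partial>lborel)"
    by (rule nn_integral_exp_substitution) auto
  also have "\<dots> = (\<integral>\<^sup>+u. 0 \<partial>(lborel :: real measure))"
    using eq by (intro nn_integral_cong_AE) (auto elim!: eventually_mono simp: indicator_def)
  finally have "(\<integral>\<^sup>+x. ennreal (cmod (f (exp (- x)) - g (exp (- x)))) \<partial>lborel) = 0"
    by simp
  then have "AE x in lborel. ennreal (cmod (f (exp (- x)) - g (exp (- x)))) = 0"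
    by (subst (asm) nn_integral_0_iff_AE) auto
  then show ?thesis
    by (auto elim!: eventually_mono)
qed

text \<open>Since \<open>exp (- x)\<close> is positive, the \<open>undefined\<close> values of the
  restrictions in \<open>S1\<close> and \<open>S2\<close> are never reached.\<close>

lemma T1_eq: "T1 f x = complex_of_real (sqrt (exp (- x))) * fourier f (exp (- x))"
  by (simp add: T1_def S1_def S2_def S3_def)

lemma H_space_L2: "f \<in> H_space \<Longrightarrow> f \<in> L2 lborel"
  by (simp add: H_space_def)

lemma T1_L2:
  assumes f: "f \<in> L2 lborel"
  shows "T1 f \<in> L2 lborel"
proof -
  have [measurable]: "fourier f \<in> borel_measurable borel"
    using fourier_spec(1)[OF f] by (simp add: L2_def)
  have [measurable]: "T1 f \<in> borel_measurable borel"
    unfolding T1_eq[abs_def] by measurable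
  have "(\<integral>\<^sup>+x. ennreal ((cmod (T1 f x))\<^sup>2) \<partial>lborel)
      = (\<integral>\<^sup>+u. ennreal (indicator {0<..} u / (1 * u)) * ennreal ((cmod (T1 f (- ln u / 1)))\<^sup>2) \<partial>lborel)"
    by (rule nn_integral_exp_substitution) auto
  \<comment> \<open>The squared factor \<open>sqrt u\<close> cancels the Jacobian
    \<open>1 / u\<close>. Only an inequality results, because negative frequencies are lost.\<close>
  also have "\<dots> \<le> (\<integral>\<^sup>+u. ennreal ((cmod (fourier f u))\<^sup>2) \<partial>lborel)"
    by (intro nn_integral_mono)
      (auto simp: indicator_def T1_eq norm_mult power_mult_distrib simp flip: ennreal_mult)
  also have "\<dots> < \<infinity>"
    using fourier_spec(1)[OF f] by (simp add: L2_iff_nn_integral)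
  finally show ?thesis
    by (simp add: L2_iff_nn_integral)
qed

lemma T1_inner:
  assumes f: "f \<in> H_space" and g: "g \<in> H_space"
  shows "L2_inner lborel (T1 f) (T1 g) = L2_inner lborel f g"
proof -
  note L2 = H_space_L2[OF f] H_space_L2[OF g]
  have [measurable]: "fourier f \<in> borel_measurable borel" "fourier g \<in> borel_measurable borel"
    using fourier_spec(1) L2 by (auto simp: L2_def)
  have [measurable]: "T1 f \<in> borel_measurable borel" "T1 g \<in> borel_measurable borel"
    unfolding T1_eq[abs_def] by measurable
  have "L2_inner lborel (T1 f) (T1 g)
      = (LINT u|lborel. (indicator {0<..} u / (1 * u)) *\<^sub>R (cnj (T1 f (- ln u / 1)) * T1 g (- ln u / 1)))"
    unfolding L2_inner_def by (rule integral_exp_substitution) auto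
  also have "\<dots> = (LINT u|lborel. cnj (fourier f u) * fourier g u)"
  proof (rule integral_cong_AE)
    have "AE u in lborel. u < 0 \<longrightarrow> fourier f u = 0"
      using f by (simp add: H_space_def)
    \<comment> \<open>Positive \<open>u\<close> are covered by the substitution and negative
      \<open>u\<close> by membership in \<open>H_space\<close>; the point 0 belongs to neither and
      is discarded as a null set.\<close>
    then show "AE u in lborel. (indicator {0<..} u / (1 * u)) *\<^sub>R (cnj (T1 f (- ln u / 1)) * T1 g (- ln u / 1))
        = cnj (fourier f u) * fourier g u"
      using AE_lborel_singleton[of 0]
    proof eventually_elim
      case (elim u)
      show ?case
      proof (cases "u > 0")
        case True
        then have "complex_of_real (sqrt u) * complex_of_real (sqrt u) = complex_of_real u"
          by (simp flip: of_real_mult)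
        then have "cnj (T1 f (- ln u / 1)) * T1 g (- ln u / 1) = complex_of_real u * (cnj (fourier f u) * fourier g u)"
          using True by (simp add: T1_eq)
        then show ?thesis
          using True by (simp add: scaleR_conv_of_real)
      qed (use elim in auto)
    qed
  qed measurable
  also have "\<dots> = L2_inner lborel f g"
    using Plancherel_inner[OF L2] by (simp add: L2_inner_def)
  finally show ?thesis .
qed

lemma T1_norm:
  assumes f: "f \<in> H_space"
  shows "L2_norm lborel (T1 f) = L2_norm lborel f"
  using T1_inner[OF f f]
  unfolding L2_inner_self of_real_eq_iff by (simp add: power2_eq_iff_nonneg)

lemma T1_surj:
  assumes g: "g \<in> L2 lborel"
  obtains f where "f \<in> H_space" "AE x in lborel. T1 f x = g x"
proof -
  have [measurable]: "g \<in> borel_measurable borel"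
    using g by (simp add: L2_def)
  \<comment> \<open>This inverts \<open>S3\<close> and \<open>S2\<close> on the positive half-line;
    the extension by zero puts any preimage under the Fourier transform into
    \<open>H_space\<close>.\<close>
  define h where "h u = indicator {0<..} u * g (- ln u) / complex_of_real (sqrt u)" for u
  have [measurable]: "h \<in> borel_measurable borel"
    unfolding h_def by measurable
  have "(\<integral>\<^sup>+x. ennreal ((cmod (g x))\<^sup>2) \<partial>lborel)
      = (\<integral>\<^sup>+u. ennreal (indicator {0<..} u / (1 * u)) * ennreal ((cmod (g (- ln u / 1)))\<^sup>2) \<partial>lborel)"
    by (rule nn_integral_exp_substitution) auto
  also have "\<dots> = (\<integral>\<^sup>+u. ennreal ((cmod (h u))\<^sup>2) \<partial>lborel)"
    by (intro nn_integral_cong)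
      (auto simp: h_def indicator_def norm_mult norm_divide power_divide simp flip: ennreal_mult)
  finally have "h \<in> L2 lborel"
    using g by (simp add: L2_iff_nn_integral)
  then obtain f where f: "f \<in> L2 lborel" "AE w in lborel. fourier f w = h w"
    using fourier_surj by blast
  have [measurable]: "fourier f \<in> borel_measurable borel"
    using fourier_spec(1)[OF f(1)] by (simp add: L2_def)
  show ?thesis
  proof (rule that)
    have "AE w in lborel. w < 0 \<longrightarrow> fourier f w = 0"
      using f(2) by eventually_elim (simp add: h_def)
    then show "f \<in> H_space"
      using f(1) by (simp add: H_space_def)
    have "AE x in lborel. fourier f (exp (- x)) = h (exp (- x))"
      using f(2) by (intro AE_exp_substitution) (auto elim!: eventually_mono)
    then show "AE x in lborel. T1 f x = g x"
      by eventually_elim (simp add: T1_eq h_def)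
  qed
qed

lemma I_op_spec:
  assumes "g \<in> L2 lborel"
  shows "I_op g \<in> H_space" "AE x in lborel. T1 (I_op g) x = g x"
proof -
  have "\<exists>f. f \<in> H_space \<and> (AE x in lborel. T1 f x = g x)"
    using T1_surj[OF assms] by metis
  from someI_ex[OF this] show "I_op g \<in> H_space" "AE x in lborel. T1 (I_op g) x = g x"
    unfolding I_op_def by auto
qed

section \<open>The frame\<close>

text \<open>In the variable \<open>u = exp (- \<epsilon> * y)\<close> the chirp is a pure
  exponential of period \<open>D\<close>. The weight in \<open>fin\<close> is the one under which
  the substituted function \<open>G\<close> has finite L2 norm.\<close>

lemma exp_chirp_Parseval:
  fixes \<epsilon> L :: real
  assumes \<epsilon>: "\<epsilon> > 0" and L: "L > 0"
    and [measurable]: "k \<in> borel_measurable borel" and supp: "\<And>y. y \<notin> {- L..L} \<Longrightarrow> k y = 0"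
    and fin: "(\<integral>\<^sup>+y. ennreal (exp (\<epsilon> * y) * (cmod (k y))\<^sup>2) \<partial>lborel) < \<infinity>"
    and D_def: "D = exp (\<epsilon> * L) - exp (- \<epsilon> * L)"
  shows "(\<integral>\<^sup>+m. ennreal ((cmod (LINT y|lborel. k y * cis (- (2 * pi * of_int m * exp (- \<epsilon> * y) / D))))\<^sup>2)
      \<partial>count_space (UNIV :: int set))
    = ennreal (D / \<epsilon>) * (\<integral>\<^sup>+y. ennreal (exp (\<epsilon> * y) * (cmod (k y))\<^sup>2) \<partial>lborel)"
proof -
  have D: "D > 0"
    using \<epsilon> L by (simp add: D_def)
  \<comment> \<open>With the Jacobian inside \<open>G\<close> the given integrals are exactly
    Fourier coefficients of \<open>G\<close>. Its square contains the Jacobian twice: one factor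
    returns to \<open>dy\<close>, the other becomes
    \<open>exp (\<epsilon> * y) / \<epsilon>\<close>.\<close>
  define G where "G u = (indicator {0<..} u / (\<epsilon> * u)) *\<^sub>R k (- ln u / \<epsilon>)" for u
  have [measurable]: "G \<in> borel_measurable borel"
    unfolding G_def by measurable
  have "(\<integral>\<^sup>+y. ennreal (1 / \<epsilon> * (exp (\<epsilon> * y) * (cmod (k y))\<^sup>2)) \<partial>lborel)
      = (\<integral>\<^sup>+u. ennreal (indicator {0<..} u / (\<epsilon> * u)) *
          ennreal (1 / \<epsilon> * (exp (\<epsilon> * (- ln u / \<epsilon>)) * (cmod (k (- ln u / \<epsilon>)))\<^sup>2)) \<partial>lborel)"
    by (rule nn_integral_exp_substitution[OF \<epsilon>]) measurable
  also have "\<dots> = (\<integral>\<^sup>+u. ennreal ((cmod (G u))\<^sup>2) \<partial>lborel)"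
  proof (rule nn_integral_cong)
    fix u :: real
    have "indicator {0<..} u / (\<epsilon> * u) * (1 / \<epsilon> * (exp (\<epsilon> * (- ln u / \<epsilon>)) * (cmod (k (- ln u / \<epsilon>)))\<^sup>2))
        = (cmod (G u))\<^sup>2"
    proof (cases "u > 0")
      case True
      then have "exp (\<epsilon> * (- ln u / \<epsilon>)) = 1 / u"
        using \<epsilon> by (simp add: exp_minus inverse_eq_divide)
      then show ?thesis
        using True \<epsilon> by (simp add: G_def power_mult_distrib power_divide power2_eq_square)
    qed (simp add: G_def)
    then show "ennreal (indicator {0<..} u / (\<epsilon> * u)) *
        ennreal (1 / \<epsilon> * (exp (\<epsilon> * (- ln u / \<epsilon>)) * (cmod (k (- ln u / \<epsilon>)))\<^sup>2)) = ennreal ((cmod (G u))\<^sup>2)"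
      using \<epsilon> by (subst ennreal_mult[symmetric]) (auto simp: indicator_def)
  qed
  also have "(\<integral>\<^sup>+y. ennreal (1 / \<epsilon> * (exp (\<epsilon> * y) * (cmod (k y))\<^sup>2)) \<partial>lborel)
      = ennreal (1 / \<epsilon>) * (\<integral>\<^sup>+y. ennreal (exp (\<epsilon> * y) * (cmod (k y))\<^sup>2) \<partial>lborel)"
  proof -
    have "ennreal (1 / \<epsilon> * (exp (\<epsilon> * y) * (cmod (k y))\<^sup>2)) = ennreal (1 / \<epsilon>) * ennreal (exp (\<epsilon> * y) * (cmod (k y))\<^sup>2)" for y
      using \<epsilon> by (intro ennreal_mult) auto
    then show ?thesis
      by (simp only:) (rule nn_integral_cmult, measurable)
  qed
  finally have norm_G: "(\<integral>\<^sup>+u. ennreal ((cmod (G u))\<^sup>2) \<partial>lborel)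
      = ennreal (1 / \<epsilon>) * (\<integral>\<^sup>+y. ennreal (exp (\<epsilon> * y) * (cmod (k y))\<^sup>2) \<partial>lborel)" ..
  \<comment> \<open>The right endpoint is \<open>exp (\<epsilon> * L)\<close>, so this interval is
    the image of \<open>{- L..L}\<close> with the endpoints exchanged.\<close>
  have G_supp: "G u = 0" if "u \<notin> {exp (- \<epsilon> * L)..exp (- \<epsilon> * L) + D}" for u
  proof (cases "u > 0")
    case True
    have "- ln u / \<epsilon> \<notin> {- L..L}"
    proof
      assume "- ln u / \<epsilon> \<in> {- L..L}"
      then have "- \<epsilon> * L \<le> ln u" "ln u \<le> \<epsilon> * L"
        using \<epsilon> by (auto simp: field_simps)
      then have "exp (- \<epsilon> * L) \<le> u" "u \<le> exp (\<epsilon> * L)"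
        using True by (metis exp_le_cancel_iff exp_ln)+
      then show False
        using that by (simp add: D_def)
    qed
    then show ?thesis
      by (simp add: G_def supp)
  qed (simp add: G_def)
  have "(LINT y|lborel. k y * cis (- (2 * pi * of_int m * exp (- \<epsilon> * y) / D)))
      = (LINT u|lborel. G u * cis (- (2 * pi * of_int m * u / D)))" for m
  proof -
    have "(LINT y|lborel. k y * cis (- (2 * pi * of_int m * exp (- \<epsilon> * y) / D)))
      = (LINT u|lborel. (indicator {0<..} u / (\<epsilon> * u)) *\<^sub>R
          (k (- ln u / \<epsilon>) * cis (- (2 * pi * of_int m * exp (- \<epsilon> * (- ln u / \<epsilon>)) / D))))"
      by (rule integral_exp_substitution[OF \<epsilon>]) measurable
    also have "\<dots> = (LINT u|lborel. G u * cis (- (2 * pi * of_int m * u / D)))"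
      using \<epsilon> by (intro Bochner_Integration.integral_cong) (auto simp: G_def indicator_def)
    finally show ?thesis .
  qed
  moreover have "G \<in> L2 lborel"
    using fin by (simp add: L2_iff_nn_integral norm_G ennreal_mult_less_top)
  ultimately have "(\<integral>\<^sup>+m. ennreal ((cmod (LINT y|lborel. k y * cis (- (2 * pi * of_int m * exp (- \<epsilon> * y) / D))))\<^sup>2)
      \<partial>count_space (UNIV :: int set)) = ennreal D * (\<integral>\<^sup>+u. ennreal ((cmod (G u))\<^sup>2) \<partial>lborel)"
    using Fourier_series_Parseval[OF D _ G_supp] by simp
  also have "\<dots> = ennreal (D / \<epsilon>) * (\<integral>\<^sup>+y. ennreal (exp (\<epsilon> * y) * (cmod (k y))\<^sup>2) \<partial>lborel)"
    unfolding norm_G using \<epsilon> D by (simp add: mult.assoc[symmetric] flip: ennreal_mult)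
  finally show ?thesis .
qed

section \<open>Compatibility of the representation with null sets and with \<open>T1\<close>\<close>

lemma AE_lborel_shift:
  fixes c :: real
  assumes "AE x in lborel. P x"
  shows "AE x in lborel. P (x + c)"
proof -
  have "AE x in distr lborel borel ((+) c). P x"
    using assms by (simp only: lborel_distr_plus)
  then have "AE x in lborel. P (c + x)"
    by (rule AE_distrD[rotated]) simp
  then show ?thesis
    by (simp only: add.commute)
qed

lemma rho_L2:
  assumes f: "f \<in> L2 lborel"
  shows "rho \<epsilon> a b (\<alpha>, \<beta>, \<gamma>) f \<in> L2 lborel"
proof -
  have [measurable]: "f \<in> borel_measurable borel"
    using f by (simp add: L2_def)
  let ?g = "\<lambda>x. f (- (ln \<alpha> / \<epsilon>) + 1 * x)"
  have "integrable lborel (\<lambda>x. (cmod (?g x))\<^sup>2)"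
    using f by (intro lborel_integrable_real_affine[of "\<lambda>x. (cmod (f x))\<^sup>2"]) (auto simp: L2_def)
  then have "?g \<in> L2 lborel"
    by (simp add: L2_def)
  then show ?thesis
    by (rule L2_bounded_by) (simp_all add: rho_def norm_mult)
qed

lemma rho_cong_AE:
  assumes "AE x in lborel. f x = g x"
  shows "AE x in lborel. rho \<epsilon> a b (\<alpha>, \<beta>, \<gamma>) f x = rho \<epsilon> a b (\<alpha>, \<beta>, \<gamma>) g x"
  using AE_lborel_shift[OF assms, of "- (ln \<alpha> / \<epsilon>)"] by eventually_elim (simp add: rho_def)

lemma pi_rep_in_H_space:
  assumes "f \<in> H_space"
  shows "pi_rep \<epsilon> a b (\<alpha>, \<beta>, \<gamma>) f \<in> H_space"
  using I_op_spec(1)[OF rho_L2[OF T1_L2[OF H_space_L2[OF assms]]]] by (simp add: pi_rep_def)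

text \<open>Isometry of \<open>T1\<close> moves the inner product to L2 of the line. There
  \<open>T1\<close> cancels each \<open>I_op\<close> only almost everywhere, and the inner
  cancellation passes through \<open>rho\<close> because a translation preserves null sets.\<close>

lemma inner_pi_rep:
  assumes f: "f \<in> H_space" and g: "g \<in> L2 lborel"
  shows "L2_inner lborel f (pi_rep \<epsilon> a b (\<alpha>, \<beta>, \<gamma>) (I_op g)) = L2_inner lborel (T1 f) (rho \<epsilon> a b (\<alpha>, \<beta>, \<gamma>) g)"
proof -
  note Ig = I_op_spec[OF g]
  note T = T1_L2[OF H_space_L2[OF Ig(1)]]
  note R = I_op_spec[OF rho_L2[OF T, of \<epsilon> a b \<alpha> \<beta> \<gamma>]]
  have "L2_inner lborel f (pi_rep \<epsilon> a b (\<alpha>, \<beta>, \<gamma>) (I_op g))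
      = L2_inner lborel (T1 f) (T1 (I_op (rho \<epsilon> a b (\<alpha>, \<beta>, \<gamma>) (T1 (I_op g)))))"
    using T1_inner[OF f R(1)] by (simp add: pi_rep_def)
  also have "\<dots> = L2_inner lborel (T1 f) (rho \<epsilon> a b (\<alpha>, \<beta>, \<gamma>) g)"
  proof (rule L2_inner_cong_AE)
    show "AE x in lborel. T1 (I_op (rho \<epsilon> a b (\<alpha>, \<beta>, \<gamma>) (T1 (I_op g)))) x = rho \<epsilon> a b (\<alpha>, \<beta>, \<gamma>) g x"
      using R(2) rho_cong_AE[OF Ig(2), of \<epsilon> a b \<alpha> \<beta> \<gamma>] by eventually_elim simp
  qed (use L2_measurable[OF T1_L2[OF H_space_L2[OF f]]] L2_measurable[OF T1_L2[OF H_space_L2[OF R(1)]]]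
      L2_measurable[OF rho_L2[OF g, of \<epsilon> a b \<alpha> \<beta> \<gamma>]] in auto)
  finally show ?thesis .
qed

text \<open>The frame property is an identity at each \<open>\<epsilon>\<close> separately, so a
  single value of the parameter is treated.\<close>

lemma tight_frame_affine:
  fixes \<epsilon> L q a b chi :: real and \<psi> :: "real \<Rightarrow> complex"
    and \<alpha> :: "int \<Rightarrow> real" and \<beta> \<gamma> :: "int \<Rightarrow> int \<Rightarrow> real"
  assumes \<epsilon>: "\<epsilon> > 0" and b: "b \<noteq> 0" and L: "L > 0" and chi: "chi > 0"
    and \<psi>: "\<psi> \<in> L2 lborel"
    and supp: "AE x in lborel. x \<notin> {- L..L} \<longrightarrow> \<psi> x = 0"
    and resolve: "\<And>x. ((\<lambda>n::int. (cmod (\<psi> (x + of_int n * q)))\<^sup>2) has_sum chi) UNIV"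
    and \<alpha>: "\<And>n. \<alpha> n = exp (- \<epsilon> * of_int n * q)"
    and \<beta>: "\<And>m n. \<beta> m n = - (2 * pi * of_int m * exp (- \<epsilon> * of_int n * q) / (b * (exp (\<epsilon> * L) - exp (- \<epsilon> * L))))"
  shows "tight_frame lborel H_space
      (\<lambda>(n, m). pi_rep \<epsilon> a b (\<alpha> n, \<beta> m n, \<gamma> m n) (I_op (\<lambda>x. complex_of_real (exp (- (1 / 2) * \<epsilon> * x)) * \<psi> x)))
      (2 * (sinh (\<epsilon> * L) / \<epsilon>) * chi)"
proof -
  define D where "D = exp (\<epsilon> * L) - exp (- \<epsilon> * L)"
  have D: "D > 0"
    using \<epsilon> L by (simp add: D_def)
  define K where "K = 2 * (sinh (\<epsilon> * L) / \<epsilon>) * chi"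
  have "2 * sinh (\<epsilon> * L) = D"
    by (simp add: D_def sinh_def)
  then have K_eq: "K = D / \<epsilon> * chi"
    by (simp add: K_def flip: \<open>2 * sinh (\<epsilon> * L) = D\<close>)
  have K: "K > 0"
    unfolding K_eq using D \<epsilon> chi by simp
  have [measurable]: "\<psi> \<in> borel_measurable borel"
    using \<psi> by (simp add: L2_def)
  define w where "w x = complex_of_real (exp (- (1 / 2) * \<epsilon> * x)) * \<psi> x" for x
  \<comment> \<open>The support condition on \<open>\<psi>\<close> holds almost everywhere, whereas
    the chirp expansion asks for vanishing at every outside point; \<open>\<psi>'\<close> is a
    representative that does so.\<close>
  define \<psi>' where "\<psi>' x = indicator {- L..L} x * \<psi> x" for x
  define w' where "w' x = complex_of_real (exp (- (1 / 2) * \<epsilon> * x)) * \<psi>' x" for x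
  have [measurable]: "\<psi>' \<in> borel_measurable borel" "w \<in> borel_measurable borel" "w' \<in> borel_measurable borel"
    unfolding \<psi>'_def w_def w'_def by measurable
  have \<psi>'_eq: "AE x in lborel. \<psi>' x = \<psi> x"
    using supp by eventually_elim (auto simp: \<psi>'_def indicator_def)
  then have w_eq: "AE x in lborel. w' x = w x"
    by eventually_elim (simp add: w_def w'_def)
  have resolve_nn: "(\<integral>\<^sup>+n. ennreal ((cmod (\<psi> (x + of_int n * q)))\<^sup>2) \<partial>count_space (UNIV :: int set)) = ennreal chi" for x
    by (rule nn_integral_count_space_of_has_sum[OF resolve]) simp
  \<comment> \<open>Each term of the resolved sum is at most \<open>chi\<close>, so \<open>\<psi>\<close> is bounded and its product with
    an arbitrary \<open>L\<^sup>2\<close> function stays in \<open>L\<^sup>2\<close>.\<close>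
  have \<psi>_bound: "(cmod (\<psi> x))\<^sup>2 \<le> chi" for x
    using nn_integral_ge_point[of "0::int" UNIV "\<lambda>n. ennreal ((cmod (\<psi> (x + of_int n * q)))\<^sup>2)"] chi
    unfolding resolve_nn by simp
  have w'_L2: "w' \<in> L2 lborel"
  \<comment> \<open>The constant \<open>exp (\<epsilon> * L)\<close> is a generous bound for the
    weight on \<open>{- L..L}\<close>, where its exponent is at most
    \<open>\<epsilon> * L / 2\<close>.\<close>
  proof (rule L2_bounded_by[OF L2_cmult[OF \<psi>, of "complex_of_real (exp (\<epsilon> * L))"]])
    fix x
    show "cmod (w' x) \<le> cmod (complex_of_real (exp (\<epsilon> * L)) * \<psi> x)"
    proof (cases "x \<in> {- L..L}")
      case True
      have "\<epsilon> * - x \<le> \<epsilon> * (2 * L)"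
        using True L \<epsilon> by (intro mult_left_mono) auto
      then have "exp (- (1 / 2) * \<epsilon> * x) \<le> exp (\<epsilon> * L)"
        by simp
      then show ?thesis
        using True by (simp add: w'_def \<psi>'_def norm_mult mult_right_mono)
    qed (simp add: w'_def \<psi>'_def)
  qed measurable
  then have w_L2: "w \<in> L2 lborel"
    by (rule L2_cong_AE[OF w_eq]) measurable
  let ?\<phi> = "\<lambda>n m. pi_rep \<epsilon> a b (\<alpha> n, \<beta> m n, \<gamma> m n) (I_op w)"
  have "((\<lambda>(n, m). (cmod (L2_inner lborel f (?\<phi> n m)))\<^sup>2) has_sum K * (L2_norm lborel f)\<^sup>2) UNIV"
    if f: "f \<in> H_space" for f
  proof -
    define h where "h = T1 f"
    have h: "h \<in> L2 lborel"
      unfolding h_def by (rule T1_L2[OF H_space_L2[OF f]])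
    have [measurable]: "h \<in> borel_measurable borel"
      using h by (simp add: L2_def)
    define k where "k n y = cnj (h (y - of_int n * q)) * w' y" for n :: int and y
    have [measurable]: "k n \<in> borel_measurable borel" for n
      unfolding k_def by measurable
    have inner: "cmod (L2_inner lborel f (?\<phi> n m))
        = cmod (LINT y|lborel. k n y * cis (- (2 * pi * of_int m * exp (- \<epsilon> * y) / D)))" for n m
    proof -
      let ?s = "of_int n * q"
      let ?c = "cis (a * \<gamma> m n)"
      have shift: "ln (\<alpha> n) / \<epsilon> = - ?s"
        using \<epsilon> by (simp add: \<alpha>)
      \<comment> \<open>After the translation by \<open>?s\<close> the factor
        \<open>exp (- \<epsilon> * of_int n * q)\<close> in \<open>\<beta>\<close> removes
        \<open>n\<close> from the chirp, and the denominator \<open>b\<close> in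
        \<open>\<beta>\<close> cancels the \<open>b\<close> of the representation.\<close>
      have phase: "b * \<beta> m n * exp (- \<epsilon> * (y - ?s)) = - (2 * pi * of_int m * exp (- \<epsilon> * y) / D)" for y
      proof -
        have "exp (- \<epsilon> * of_int n * q) * exp (- \<epsilon> * (y - ?s)) = exp (- \<epsilon> * y)"
          by (simp add: algebra_simps flip: exp_add)
        moreover have "b * \<beta> m n = - (2 * pi * of_int m * exp (- \<epsilon> * of_int n * q) / D)"
          using b by (simp add: \<beta> D_def)
        ultimately show ?thesis
          by (simp add: mult.assoc)
      qed
      have "L2_inner lborel f (?\<phi> n m) = L2_inner lborel h (rho \<epsilon> a b (\<alpha> n, \<beta> m n, \<gamma> m n) w)"
        unfolding h_def by (rule inner_pi_rep[OF f w_L2])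
      also have "\<dots> = L2_inner lborel h (rho \<epsilon> a b (\<alpha> n, \<beta> m n, \<gamma> m n) w')"
      proof (rule L2_inner_cong_AE)
        show "AE x in lborel. rho \<epsilon> a b (\<alpha> n, \<beta> m n, \<gamma> m n) w x = rho \<epsilon> a b (\<alpha> n, \<beta> m n, \<gamma> m n) w' x"
          using rho_cong_AE[OF w_eq, of \<epsilon> a b "\<alpha> n" "\<beta> m n" "\<gamma> m n"] by eventually_elim simp
      qed (use L2_measurable[OF h] L2_measurable[OF rho_L2[OF w_L2, of \<epsilon> a b "\<alpha> n" "\<beta> m n" "\<gamma> m n"]]
          L2_measurable[OF rho_L2[OF w'_L2, of \<epsilon> a b "\<alpha> n" "\<beta> m n" "\<gamma> m n"]] in auto)
      also have "\<dots> = (LINT x|lborel. cnj (h x) * (?c * cis (b * \<beta> m n * exp (- \<epsilon> * x)) * w' (x + ?s)))"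
        by (simp add: L2_inner_def rho_def shift)
      also have "\<dots> = (LINT y|lborel. cnj (h (- ?s + 1 * y)) *
          (?c * cis (b * \<beta> m n * exp (- \<epsilon> * (- ?s + 1 * y))) * w' (- ?s + 1 * y + ?s)))"
        by (subst lborel_integral_real_affine[where c=1 and t="- ?s"]) simp_all
      also have "\<dots> = (LINT y|lborel. ?c * (k n y * cis (- (2 * pi * of_int m * exp (- \<epsilon> * y) / D))))"
      proof (rule Bochner_Integration.integral_cong[OF refl])
        fix y
        have shifts: "- ?s + 1 * y = y - ?s" "y - ?s + ?s = y"
          by simp_all
        show "cnj (h (- ?s + 1 * y)) * (?c * cis (b * \<beta> m n * exp (- \<epsilon> * (- ?s + 1 * y))) * w' (- ?s + 1 * y + ?s))
            = ?c * (k n y * cis (- (2 * pi * of_int m * exp (- \<epsilon> * y) / D)))"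
          unfolding shifts phase k_def by (simp only: mult_ac)
      qed
      also have "\<dots> = ?c * (LINT y|lborel. k n y * cis (- (2 * pi * of_int m * exp (- \<epsilon> * y) / D)))"
        by (rule integral_mult_right_zero)
      finally show ?thesis
        by (simp add: norm_mult)
    qed
    \<comment> \<open>Here the weight of the window pays off: its square cancels
      \<open>exp (\<epsilon> * y)\<close>, and the unweighted \<open>\<psi>'\<close> remains, to
      which the sum over translates applies.\<close>
    have weight: "exp (\<epsilon> * y) * (cmod (k n y))\<^sup>2 = (cmod (h (y - of_int n * q)))\<^sup>2 * (cmod (\<psi>' y))\<^sup>2" for n y
    proof -
      have "exp (\<epsilon> * y) * (exp (- (1 / 2) * \<epsilon> * y))\<^sup>2 = 1"
        by (simp add: power2_eq_square flip: exp_add)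
      then show ?thesis
        by (simp add: k_def w'_def norm_mult power_mult_distrib mult_ac)
    qed
    have shifted: "(\<integral>\<^sup>+y. ennreal (exp (\<epsilon> * y) * (cmod (k n y))\<^sup>2) \<partial>lborel)
        = (\<integral>\<^sup>+x. ennreal ((cmod (h x))\<^sup>2) * ennreal ((cmod (\<psi> (x + of_int n * q)))\<^sup>2) \<partial>lborel)" for n
    proof -
      have "(\<integral>\<^sup>+y. ennreal (exp (\<epsilon> * y) * (cmod (k n y))\<^sup>2) \<partial>lborel)
          = (\<integral>\<^sup>+x. ennreal ((cmod (h (of_int n * q + 1 * x - of_int n * q)))\<^sup>2 * (cmod (\<psi>' (of_int n * q + 1 * x)))\<^sup>2) \<partial>lborel)"
        unfolding weight by (subst nn_integral_real_affine[where c=1 and t="of_int n * q"]) simp_all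
      also have "\<dots> = (\<integral>\<^sup>+x. ennreal ((cmod (h x))\<^sup>2) * ennreal ((cmod (\<psi> (x + of_int n * q)))\<^sup>2) \<partial>lborel)"
        using AE_lborel_shift[OF \<psi>'_eq, of "of_int n * q"]
        by (intro nn_integral_cong_AE) (auto elim!: eventually_mono simp: add.commute ennreal_mult)
      finally show ?thesis .
    qed
    have norm_h: "(\<integral>\<^sup>+x. ennreal ((cmod (h x))\<^sup>2) \<partial>lborel) = ennreal ((L2_norm lborel f)\<^sup>2)"
      unfolding nn_integral_L2[OF h] by (simp add: h_def T1_norm[OF f])
    have h_fin: "(\<integral>\<^sup>+x. ennreal ((cmod (h x))\<^sup>2) \<partial>lborel) < \<infinity>"
      by (simp add: norm_h)
    have sum_m: "(\<integral>\<^sup>+m. ennreal ((cmod (L2_inner lborel f (?\<phi> n m)))\<^sup>2) \<partial>count_space UNIV)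
        = ennreal (D / \<epsilon>) * (\<integral>\<^sup>+x. ennreal ((cmod (h x))\<^sup>2) * ennreal ((cmod (\<psi> (x + of_int n * q)))\<^sup>2) \<partial>lborel)" for n
    proof -
      have "(\<integral>\<^sup>+x. ennreal ((cmod (h x))\<^sup>2) * ennreal ((cmod (\<psi> (x + of_int n * q)))\<^sup>2) \<partial>lborel)
          \<le> (\<integral>\<^sup>+x. ennreal ((cmod (h x))\<^sup>2) * ennreal chi \<partial>lborel)"
        by (intro nn_integral_mono mult_left_mono ennreal_leI \<psi>_bound) simp
      also have "\<dots> < \<infinity>"
        using h_fin by (simp add: nn_integral_multc ennreal_mult_less_top)
      finally have "(\<integral>\<^sup>+y. ennreal (exp (\<epsilon> * y) * (cmod (k n y))\<^sup>2) \<partial>lborel) < \<infinity>"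
        unfolding shifted .
      then show ?thesis
        unfolding inner shifted[symmetric]
        by (intro exp_chirp_Parseval[OF \<epsilon> L _ _ _ D_def]) (auto simp: k_def w'_def \<psi>'_def)
    qed
    \<comment> \<open>Nonnegative terms may be summed first over \<open>m\<close>, with the sum over
      \<open>n\<close> then moved inside the integral, before convergence is known.\<close>
    have "(\<integral>\<^sup>+z. ennreal (case z of (n, m) \<Rightarrow> (cmod (L2_inner lborel f (?\<phi> n m)))\<^sup>2) \<partial>count_space (UNIV :: (int \<times> int) set))
        = (\<integral>\<^sup>+n. \<integral>\<^sup>+m. ennreal ((cmod (L2_inner lborel f (?\<phi> n m)))\<^sup>2) \<partial>count_space UNIV \<partial>count_space UNIV)"
      by (subst nn_integral_fst_count_space[symmetric]) simp
    also have "\<dots> = ennreal (D / \<epsilon>) * (\<integral>\<^sup>+n. \<integral>\<^sup>+x. ennreal ((cmod (h x))\<^sup>2) * ennreal ((cmod (\<psi> (x + of_int n * q)))\<^sup>2)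
        \<partial>lborel \<partial>count_space (UNIV :: int set))"
      unfolding sum_m by (rule nn_integral_cmult) simp
    also have "(\<integral>\<^sup>+n. \<integral>\<^sup>+x. ennreal ((cmod (h x))\<^sup>2) * ennreal ((cmod (\<psi> (x + of_int n * q)))\<^sup>2) \<partial>lborel \<partial>count_space (UNIV :: int set))
        = (\<integral>\<^sup>+x. \<integral>\<^sup>+n. ennreal ((cmod (h x))\<^sup>2) * ennreal ((cmod (\<psi> (x + of_int n * q)))\<^sup>2) \<partial>count_space (UNIV :: int set) \<partial>lborel)"
      by (rule nn_integral_count_space_nn_integral[symmetric]) auto
    also have "\<dots> = (\<integral>\<^sup>+x. ennreal ((cmod (h x))\<^sup>2) * ennreal chi \<partial>lborel)"
      by (simp add: nn_integral_cmult resolve_nn)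
    also have "\<dots> = ennreal ((L2_norm lborel f)\<^sup>2) * ennreal chi"
      by (simp add: nn_integral_multc norm_h)
    also have "ennreal (D / \<epsilon>) * \<dots> = ennreal (K * (L2_norm lborel f)\<^sup>2)"
      using D \<epsilon> chi by (simp add: K_eq mult_ac flip: ennreal_mult)
    finally show ?thesis
      using K by (intro has_sum_of_nn_integral_count_space) auto
  qed
  moreover have "?\<phi> n m \<in> H_space" for n m
    by (intro pi_rep_in_H_space I_op_spec w_L2)
  ultimately have "tight_frame lborel H_space (\<lambda>(n, m). ?\<phi> n m) K"
    using K by (auto simp: tight_frame_def case_prod_unfold)
  then show ?thesis
    by (simp only: K_def w_def[abs_def])
qed

theorem propositionV2:
  fixes A B a\<^sub>0 b\<^sub>0 L p\<^sub>0 q\<^sub>0 chi :: real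
    and a b :: "real \<Rightarrow> real"
    and \<psi> :: "real \<Rightarrow> complex"
    and \<psi>\<epsilon> :: "real \<Rightarrow> real \<Rightarrow> complex"
    and \<alpha> :: "real \<Rightarrow> int \<Rightarrow> real"
    and \<beta> \<gamma> :: "real \<Rightarrow> int \<Rightarrow> int \<Rightarrow> real"
  assumes "A \<noteq> 0" and "a\<^sub>0 + b\<^sub>0 = B"
    and "\<forall>\<epsilon>\<in>{0<..1}. a \<epsilon> = a\<^sub>0 + A / \<epsilon>"
    and "\<forall>\<epsilon>\<in>{0<..1}. b \<epsilon> = b\<^sub>0 - A / \<epsilon>"
    and "\<forall>\<epsilon>\<in>{0<..1}. b \<epsilon> \<noteq> 0"
    and "L > 0"
    and "\<psi> \<in> L2 lborel" and "\<not> (AE x in lborel. \<psi> x = 0)"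
    and "AE x in lborel. x \<notin> {- L..L} \<longrightarrow> \<psi> x = 0"
    and "p\<^sub>0 = pi / (A * L)" and "\<bar>q\<^sub>0 * p\<^sub>0\<bar> < 2 * pi"
    and "chi > 0"
    and "\<forall>x. ((\<lambda>n::int. (cmod (\<psi> (x + of_int n * q\<^sub>0)))\<^sup>2) has_sum chi) UNIV"
    and "\<forall>\<epsilon>\<in>{0<..1}. \<forall>n. \<alpha> \<epsilon> n = exp (- \<epsilon> * of_int n * q\<^sub>0)"
    and "\<forall>\<epsilon>\<in>{0<..1}. \<forall>m n. \<beta> \<epsilon> m n =
           - (2 * pi * of_int m * exp (- \<epsilon> * of_int n * q\<^sub>0)
                / (b \<epsilon> * (exp (\<epsilon> * L) - exp (- \<epsilon> * L))))"
    and "\<forall>\<epsilon>\<in>{0<..1}. \<forall>m n. \<gamma> \<epsilon> m n = \<beta> \<epsilon> m n * ln_quotient (\<alpha> \<epsilon> n)"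
    and "\<forall>\<epsilon>\<in>{0<..1}. \<psi>\<epsilon> \<epsilon> = I_op (\<lambda>x. complex_of_real (exp (- (1 / 2) * \<epsilon> * x)) * \<psi> x)"
  shows "\<forall>\<epsilon>\<in>{0<..1}.
    tight_frame lborel H_space
      (\<lambda>(n, m). pi_rep \<epsilon> (a \<epsilon>) (b \<epsilon>) (\<alpha> \<epsilon> n, \<beta> \<epsilon> m n, \<gamma> \<epsilon> m n) (\<psi>\<epsilon> \<epsilon>))
      (2 * (sinh (\<epsilon> * L) / \<epsilon>) * chi)"
proof
  fix \<epsilon> :: real assume \<epsilon>: "\<epsilon> \<in> {0<..1}"
  have "tight_frame lborel H_space
      (\<lambda>(n, m). pi_rep \<epsilon> (a \<epsilon>) (b \<epsilon>) (\<alpha> \<epsilon> n, \<beta> \<epsilon> m n, \<gamma> \<epsilon> m n)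
        (I_op (\<lambda>x. complex_of_real (exp (- (1 / 2) * \<epsilon> * x)) * \<psi> x)))
      (2 * (sinh (\<epsilon> * L) / \<epsilon>) * chi)"
    \<comment> \<open>\<open>q\<close> occurs only in premises of the rule, so unification with the
      goal cannot determine it.\<close>
    by (rule tight_frame_affine[where q=q\<^sub>0]) (use assms \<epsilon> in auto)
  then show "tight_frame lborel H_space
      (\<lambda>(n, m). pi_rep \<epsilon> (a \<epsilon>) (b \<epsilon>) (\<alpha> \<epsilon> n, \<beta> \<epsilon> m n, \<gamma> \<epsilon> m n) (\<psi>\<epsilon> \<epsilon>))
      (2 * (sinh (\<epsilon> * L) / \<epsilon>) * chi)"
    using assms(17) \<epsilon> by simp
qed

end
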